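(* Let $X\subset\mathbb{R}^n$ be closed, bounded and convex, with $\|x\|\le M$ for all $x\in X$ ($M>0$). Let $F(x)=\mathbb{E}[\Phi(x,\xi)]$ be monotone and continuous on $X^\epsilon$, suppose $\mathbb{E}[\|\Phi(x,\xi)\|^2]\le C^2$ for all $x\in X^\epsilon$ with some $C>0$, and suppose the solution set $X^*$ of VI$(X,F)$ is nonempty. Let $\xi_0,\xi_1,\dots$ be i.i.d. copies of $\xi$, let $z_0,z_1,\dots$ be independent with $z_k$ uniform on $B_n(0,\epsilon_k)$, and let $x_0$, $(\xi_j)$, $(z_i)$ be mutually independent. Let $\{\gamma_k\},\{\eta_k\},\{\epsilon_k\}$ be strictly positive sequences such that: (i) there is $K_1\ge0$ with $\frac{\gamma_k}{\eta_k\epsilon_k^2}\le\frac12\left(\frac{(n-1)!!}{n!!\,\kappa C}\right)^2$ for all $k\ge K_1$; (ii) $\epsilon_k\le\epsilon$ for all $k\ge0$; (iii) there are $\delta\in(0,0.5)$ and $K_3\ge0$ with $\frac{\gamma_k}{\eta_k\epsilon_k^2}\le\frac{\gamma_{k+1}}{\eta_{k+1}\epsilon_{k+1}^2}(1+\delta\eta_{k+1}\gamma_{k+1})$ for all $k\ge K_3$; (iv) there is $B_1>0$ with $\frac{\epsilon_k^2}{\eta_{k-1}^2\eta_k\gamma_k^3}\left(1-\frac{\min\{\epsilon_k,\epsilon_{k-1}\}}{\max\{\epsilon_k,\epsilon_{k-1}\}}\right)^2\le B_1$ for all $k\ge1$; (v) there is $B_2>0$ with $\frac{\epsilon_k^2}{\eta_k\gamma_k^3}\left(1-\frac{\eta_k}{\eta_{k-1}}\right)^2\le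 B_2$ for all $k\ge1$; (vi) $\eta_k\le\bar\eta$ for all $k$, for some $\bar\eta>0$, and there is $K_2\ge0$ with $\eta_k\gamma_k<1$ for all $k\ge K_2$. Let $\{x_k\}$ be generated by the RSSA scheme, let $s_k$ be the unique solution of VI$(X,F_k+\eta_k\mathbf{I})$, and let $\bar K=\max\{K_1,K_2,K_3\}$. Then $$\mathbb{E}[\|x_{k+1}-s_k\|^2]\le\theta\,\frac{\gamma_k}{\eta_k\epsilon_k^2}\qquad\text{for all }k\ge\bar K,$$ where $\theta$ is any number satisfying $$\theta\ge\max\left(4M^2\frac{\eta_{\bar K}\epsilon_{\bar K}^2}{\gamma_{\bar K}},\ \frac{2C^2\epsilon^2+4M^2\bar\eta^2\epsilon^2+16n^2C^2B_1+4M^2B_2}{0.5-\delta}\right).$$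
   Context: $\|\cdot\|$ is the Euclidean norm, $B_n(y,\rho)=\{x\in\mathbb{R}^n:\|x-y\|\le\rho\}$, $\Pi_X$ is Euclidean projection onto $X$. $\epsilon>0$ is fixed and $X^\epsilon=X+B_n(0,\epsilon)$. $\xi$ is an $\mathbb{R}^d$-valued random vector, $\Phi:X^\epsilon\times\mathbb{R}^d\to\mathbb{R}^n$. For a map $H:X\to\mathbb{R}^n$, VI$(X,H)$ asks for $x^*\in X$ with $H(x^* )^T(x-x^* )\ge0$ for all $x\in X$. $\mathbf{I}$ is the identity map. RSSA scheme: $x_0\in X$ is a random vector with $\mathbb{E}[\|x_0\|^2]<\infty$ and $x_{k+1}=\Pi_X\big(x_k-\gamma_k(\Phi(x_k+z_k,\xi_k)+\eta_kx_k)\big)$ for $k\ge0$. Smoothed mapping: $F_k(x)=\mathbb{E}[F(x+z_k)]$ for $x\in X$, with $z_k$ uniform on $B_n(0,\epsilon_k)$. ($F_k$ is monotone on $X$, so VI$(X,F_k+\eta_k\mathbf{I})$ has a unique solution.) $m!!$ is the double factorial ($0!!=1$); $\kappa=1$ if $n$ is odd and $\kappa=2/\pi$ if $n$ is even. *)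

theory Defs
  imports "HOL-Probability.Probability"
begin

fun double_fact :: "nat \<Rightarrow> nat" where
  "double_fact 0 = 1"
| "double_fact (Suc 0) = 1"
| "double_fact (Suc (Suc m)) = Suc (Suc m) * double_fact m"

definition kappa :: "nat \<Rightarrow> real" where
  "kappa n = (if odd n then 1 else 2 / pi)"

definition enlargement :: "'a::real_normed_vector set \<Rightarrow> real \<Rightarrow> 'a set" where
  "enlargement X r = {x + u |x u. x \<in> X \<and> u \<in> cball 0 r}"

definition monotone_map_on :: "'a::real_inner set \<Rightarrow> ('a \<Rightarrow> 'a) \<Rightarrow> bool" where
  "monotone_map_on S H \<longleftrightarrow> (\<forall>x\<in>S. \<forall>y\<in>S. (H x - H y) \<bullet> (x - y) \<ge> 0)"

definition VI_solutions :: "'a::real_inner set \<Rightarrow> ('a \<Rightarrow> 'a) \<Rightarrow> 'a set" where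
  "VI_solutions X H = {x \<in> X. \<forall>y\<in>X. H x \<bullet> (y - x) \<ge> 0}"

definition smoothed_map ::
  "'w measure \<Rightarrow> ('w \<Rightarrow> 'a) \<Rightarrow> ('a \<Rightarrow> 'a) \<Rightarrow> 'a \<Rightarrow> 'a::euclidean_space" where
  "smoothed_map P Z F x = (\<integral>\<omega>. F (x + Z \<omega>) \<partial>P)"

(* Mutual independence of three random elements whose value spaces may have different types;
   prob_space.indep_vars needs a common value type, so independence is stated on the generated
   sigma-algebras, as in prob_space.indep_vars_def. *)
definition indep_vars3 ::
  "'w measure \<Rightarrow> 'a measure \<Rightarrow> ('w \<Rightarrow> 'a) \<Rightarrow> 'b measure \<Rightarrow> ('w \<Rightarrow> 'b) \<Rightarrow> 'c measure \<Rightarrow> ('w \<Rightarrow> 'c) \<Rightarrow> bool"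
where
  "indep_vars3 P A X B Y C Z \<longleftrightarrow>
     X \<in> measurable P A \<and> Y \<in> measurable P B \<and> Z \<in> measurable P C \<and>
     prob_space.indep_sets P
       (\<lambda>i. [sets (vimage_algebra (space P) X A),
             sets (vimage_algebra (space P) Y B),
             sets (vimage_algebra (space P) Z C)] ! i) {0, 1, 2}"

end

(* With d = x_k - s_k, nonexpansiveness of the projection gives
     |x_{k+1} - s_k|^2 <= |d - gamma_k (Phi(x_k + z_k, xi_k) + eta_k x_k)|^2,
   and the cross term is bounded from below through the pointwise monotonicity inequality
     E<d, Phi(x_k + z_k, xi_k)> = E<d, F(x_k + z_k)> >= E<d, F(s_k + z_k)> = E<d, F_k(s_k)>,
   in which the two equalities use independence of xi_k from (x_k, z_k) and of x_k from z_k.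
   Hence E|x_{k+1} - s_k|^2 <= (1 - 2 eta_k gamma_k) E|x_k - s_k|^2 + gamma_k^2 (2C^2 + 2 eta_k^2 M^2).
   The drift |s_k - s_{k-1}| is controlled by strong monotonicity of the regularized map and by the
   L1 distance between the uniform densities on two concentric balls. Induction on k, started from
   |x_{K+1} - s_K| <= 2M, combines both estimates through |u + v|^2 <= (1+q)|u|^2 + (1+1/q)|v|^2
   with q = eta_k gamma_k. *)
theory Submission
  imports Defs
begin

text \<open>Two quantities fix the scale: q = eta_k gamma_k and nu_k = gamma_k / (eta_k eps_k^2),
  with product t = gamma_k^2 / eps_k^2. Since eps_k <= eps, the noise term is at most a constant
  times t. Conditions (iv) and (v) bound the squared drift by a constant times q t, so the factor
  1/q paid for changing the reference point from s_{k-1} to s_k leaves a constant times t again. By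
  (iii), carrying the bound theta nu_{k-1} over to index k costs a factor 1 + delta q, against a
  contraction 1 - q/2. The net gain (1/2 - delta) q theta nu_k equals theta (1/2 - delta) t and has
  to absorb both constants; hence the denominator 0.5 - delta in the bound on theta. On the
  probabilistic side, the hypotheses give independence inside each noise sequence and between three
  blocks, while a step needs x_k independent of z_k and (x_k, z_k) independent of xi_k. The blocks
  are therefore merged into one independent family, of which x_k reads only finitely many
  members.\<close>

section \<open>Independence\<close>

context prob_space
begin

text \<open>Tonelli for a product law. Independence enters as factorisation of the joint law, so the
  value types of \<open>U\<close> and \<open>V\<close> may differ. \<open>V'\<close> is a variable
  with the law of \<open>V\<close>: a sample \<open>\<xi>s k\<close> can thus be replaced by
  \<open>\<xi>\<close>, through which \<open>F\<close> and the moment bound are given.\<close>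

lemma nn_integral_independent:
  assumes U[measurable]: "random_variable S U" and V[measurable]: "random_variable T V"
    and V'[measurable]: "random_variable T V'"
    and indep: "distr M (S \<Otimes>\<^sub>M T) (\<lambda>\<omega>. (U \<omega>, V \<omega>)) = distr M S U \<Otimes>\<^sub>M distr M T V"
    and eq: "distr M T V = distr M T V'"
    and f[measurable]: "f \<in> borel_measurable (S \<Otimes>\<^sub>M T)"
  shows "(\<integral>\<^sup>+\<omega>. f (U \<omega>, V \<omega>) \<partial>M) = (\<integral>\<^sup>+\<omega>. \<integral>\<^sup>+\<omega>'. f (U \<omega>, V' \<omega>') \<partial>M \<partial>M)"
proof -
  interpret DV: prob_space "distr M T V'" by (rule prob_space_distr) fact
  have "(\<integral>\<^sup>+\<omega>. f (U \<omega>, V \<omega>) \<partial>M) = (\<integral>\<^sup>+p. f p \<partial>distr M (S \<Otimes>\<^sub>M T) (\<lambda>\<omega>. (U \<omega>, V \<omega>)))"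
    by (subst nn_integral_distr) auto
  also have "\<dots> = (\<integral>\<^sup>+p. f p \<partial>(distr M S U \<Otimes>\<^sub>M distr M T V'))"
    by (simp only: indep eq)
  also have "\<dots> = (\<integral>\<^sup>+u. \<integral>\<^sup>+v. f (u, v) \<partial>distr M T V' \<partial>distr M S U)"
    by (rule DV.nn_integral_fst[symmetric]) simp
  also have "\<dots> = (\<integral>\<^sup>+\<omega>. \<integral>\<^sup>+\<omega>'. f (U \<omega>, V' \<omega>') \<partial>M \<partial>M)"
    by (subst nn_integral_distr) (auto intro!: nn_integral_cong simp: nn_integral_distr)
  finally show ?thesis .
qed

lemma integral_independent:
  fixes f :: "'b \<times> 'c \<Rightarrow> 'e::{banach, second_countable_topology}"
  assumes U[measurable]: "random_variable S U" and V[measurable]: "random_variable T V"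
    and V'[measurable]: "random_variable T V'"
    and indep: "distr M (S \<Otimes>\<^sub>M T) (\<lambda>\<omega>. (U \<omega>, V \<omega>)) = distr M S U \<Otimes>\<^sub>M distr M T V"
    and eq: "distr M T V = distr M T V'"
    and f[measurable]: "f \<in> borel_measurable (S \<Otimes>\<^sub>M T)"
    and int: "integrable M (\<lambda>\<omega>. f (U \<omega>, V \<omega>))"
  shows "(\<integral>\<omega>. f (U \<omega>, V \<omega>) \<partial>M) = (\<integral>\<omega>. \<integral>\<omega>'. f (U \<omega>, V' \<omega>') \<partial>M \<partial>M)"
proof -
  interpret DU: prob_space "distr M S U" by (rule prob_space_distr) fact
  interpret DV: prob_space "distr M T V'" by (rule prob_space_distr) fact
  interpret pair_prob_space "distr M S U" "distr M T V'" ..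
  have joint: "distr M (S \<Otimes>\<^sub>M T) (\<lambda>\<omega>. (U \<omega>, V \<omega>)) = distr M S U \<Otimes>\<^sub>M distr M T V'"
    by (simp only: indep eq)
  have "(\<integral>\<omega>. f (U \<omega>, V \<omega>) \<partial>M) = (\<integral>p. f p \<partial>distr M (S \<Otimes>\<^sub>M T) (\<lambda>\<omega>. (U \<omega>, V \<omega>)))"
    by (subst integral_distr) auto
  also have "\<dots> = (\<integral>p. f p \<partial>(distr M S U \<Otimes>\<^sub>M distr M T V'))"
    by (simp only: joint)
  also have "\<dots> = (\<integral>u. \<integral>v. f (u, v) \<partial>distr M T V' \<partial>distr M S U)"
  proof (rule integral_fst'[symmetric])
    show "integrable (distr M S U \<Otimes>\<^sub>M distr M T V') f"
      using int unfolding joint[symmetric] by (subst integrable_distr_eq) auto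
  qed
  also have "\<dots> = (\<integral>\<omega>. (\<integral>v. f (U \<omega>, v) \<partial>distr M T V') \<partial>M)"
    by (subst integral_distr) auto
  also have "\<dots> = (\<integral>\<omega>. \<integral>\<omega>'. f (U \<omega>, V' \<omega>') \<partial>M \<partial>M)"
    by (intro Bochner_Integration.integral_cong refl, subst integral_distr) auto
  finally show ?thesis .
qed

text \<open>Pushing a product law forward along \<open>f\<close> and \<open>g\<close> keeps it a
  product. This leads from \<open>indep_var\<close>, where both variables share a value type, to
  factorised laws of variables of different types.\<close>

lemma joint_distr_compose:
  assumes indep: "indep_var S U T V"
    and f[measurable]: "f \<in> measurable S S'" and g[measurable]: "g \<in> measurable T T'"
  shows "distr M (S' \<Otimes>\<^sub>M T') (\<lambda>\<omega>. (f (U \<omega>), g (V \<omega>))) =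
    distr M S' (\<lambda>\<omega>. f (U \<omega>)) \<Otimes>\<^sub>M distr M T' (\<lambda>\<omega>. g (V \<omega>))"
proof -
  have U[measurable]: "random_variable S U" and V[measurable]: "random_variable T V"
    using indep by (auto simp: indep_var_distribution_eq)
  have "distr (distr M T V) T' g = distr M T' (\<lambda>\<omega>. g (V \<omega>))"
    by (simp add: distr_distr comp_def)
  moreover have "prob_space (distr M T' (\<lambda>\<omega>. g (V \<omega>)))"
    by (rule prob_space_distr) measurable
  ultimately have "sigma_finite_measure (distr (distr M T V) T' g)"
    by (simp add: prob_space_imp_sigma_finite)
  then have "distr M S' (\<lambda>\<omega>. f (U \<omega>)) \<Otimes>\<^sub>M distr M T' (\<lambda>\<omega>. g (V \<omega>)) =
    distr (distr M S U \<Otimes>\<^sub>M distr M T V) (S' \<Otimes>\<^sub>M T') (\<lambda>(x, y). (f x, g y))"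
    by (subst pair_measure_distr[symmetric]) (simp_all add: distr_distr comp_def)
  also have "distr M S U \<Otimes>\<^sub>M distr M T V = distr M (S \<Otimes>\<^sub>M T) (\<lambda>\<omega>. (U \<omega>, V \<omega>))"
    using indep by (simp add: indep_var_distribution_eq)
  finally show ?thesis
    by (simp add: distr_distr comp_def)
qed

section \<open>From independent blocks to independence of the iterates and the fresh noise\<close>

lemma indep_vars3_prob:
  assumes indep: "indep_vars3 M S X T Y R Z"
    and A: "A \<in> sets S" and B: "B \<in> sets T" and C: "C \<in> sets R"
  shows "prob ((X -` A \<inter> space M) \<inter> (Y -` B \<inter> space M) \<inter> (Z -` C \<inter> space M)) =
    prob (X -` A \<inter> space M) * prob (Y -` B \<inter> space M) * prob (Z -` C \<inter> space M)"
proof -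
  let ?F = "\<lambda>i. [sets (vimage_algebra (space M) X S), sets (vimage_algebra (space M) Y T),
             sets (vimage_algebra (space M) Z R)] ! i"
  let ?A = "\<lambda>i. [X -` A \<inter> space M, Y -` B \<inter> space M, Z -` C \<inter> space M] ! i"
  have XYZ: "X \<in> space M \<rightarrow> space S" "Y \<in> space M \<rightarrow> space T" "Z \<in> space M \<rightarrow> space R"
    using indep by (auto simp: indep_vars3_def dest: measurable_space)
  have "indep_sets ?F {0, 1, 2}"
    using indep by (simp add: indep_vars3_def)
  then have "prob (\<Inter>i\<in>{0, 1, 2}. ?A i) = (\<Prod>i\<in>{0, 1, 2}. prob (?A i))"
  proof (rule indep_setsD)
    show "\<forall>i\<in>{0, 1, 2}. ?A i \<in> ?F i"
      using A B C XYZ by (auto simp: sets_vimage_algebra2)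
  qed auto
  then show ?thesis
    by (simp add: Int_assoc mult.assoc)
qed

text \<open>Block independence speaks of whole sequences, so an event about finitely many
  \<open>Y j\<close> must be the preimage of one set of the infinite product: the cylinder over
  \<open>J\<close>. The leading \<open>space M\<close> gives the intersection its meaning for empty
  \<open>J\<close>.\<close>

lemma indep_vars_vimage_restrict:
  assumes indep: "indep_vars (\<lambda>_. S) Y UNIV" and J: "finite J" and A: "\<And>j. j \<in> J \<Longrightarrow> A j \<in> sets S"
  obtains B where "B \<in> sets (PiM UNIV (\<lambda>_. S))"
    and "(\<lambda>\<omega> j. Y j \<omega>) -` B \<inter> space M = space M \<inter> (\<Inter>j\<in>J. Y j -` A j \<inter> space M)"
    and "prob ((\<lambda>\<omega> j. Y j \<omega>) -` B \<inter> space M) = (\<Prod>j\<in>J. prob (Y j -` A j \<inter> space M))"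
proof -
  define B where "B = prod_emb UNIV (\<lambda>_. S) J (Pi\<^sub>E J A)"
  have Y: "Y j \<in> measurable M S" for j
    using indep by (auto simp: indep_vars_def)
  have B: "B \<in> sets (PiM UNIV (\<lambda>_. S))"
    unfolding B_def using J A by (intro sets_PiM_I) auto
  have eq: "(\<lambda>\<omega> j. Y j \<omega>) -` B \<inter> space M = space M \<inter> (\<Inter>j\<in>J. Y j -` A j \<inter> space M)"
    using measurable_space[OF Y] by (auto simp: B_def prod_emb_def restrict_def PiE_def Pi_iff extensional_def)
  have "prob ((\<lambda>\<omega> j. Y j \<omega>) -` B \<inter> space M) = (\<Prod>j\<in>J. prob (Y j -` A j \<inter> space M))"
  proof (cases "J = {}")
    case True
    then show ?thesis unfolding eq by (simp add: prob_space)
  next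
    case False
    then have "space M \<inter> (\<Inter>j\<in>J. Y j -` A j \<inter> space M) = (\<Inter>j\<in>J. Y j -` A j \<inter> space M)"
      by auto
    then show ?thesis
      unfolding eq using indep_varsD[OF indep False J _ A] by simp
  qed
  with B eq show ?thesis by (rule that)
qed


text \<open>The probability of a finite intersection factorises first between the three blocks and
  then inside the two sequences. The index \<open>None\<close> stands for \<open>X\<close>,
  \<open>Inl\<close> for \<open>Y\<close>, \<open>Inr\<close> for \<open>Z\<close>; families of
  preimages are used because the value types differ.\<close>

lemma indep_vars3_merge:
  fixes Y :: "'i \<Rightarrow> 'a \<Rightarrow> 'b::topological_space" and Z :: "'j \<Rightarrow> 'a \<Rightarrow> 'c::topological_space"
  assumes Y: "indep_vars (\<lambda>_. borel) Y UNIV" and Z: "indep_vars (\<lambda>_. borel) Z UNIV"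
    and indep: "indep_vars3 M S X (PiM UNIV (\<lambda>_. borel)) (\<lambda>\<omega> j. Y j \<omega>)
      (PiM UNIV (\<lambda>_. borel)) (\<lambda>\<omega> j. Z j \<omega>)"
  shows "indep_sets (\<lambda>i. case i of None \<Rightarrow> {X -` A \<inter> space M | A. A \<in> sets S}
      | Some (Inl j) \<Rightarrow> {Y j -` A \<inter> space M | A. A \<in> sets borel}
      | Some (Inr j) \<Rightarrow> {Z j -` A \<inter> space M | A. A \<in> sets borel}) UNIV" (is "indep_sets ?F UNIV")
proof (rule indep_setsI)
  have meas: "random_variable S X" "random_variable borel (Y i)" "random_variable borel (Z j)" for i j
    using indep Y Z by (auto simp: indep_vars3_def indep_vars_def)
  show "?F i \<subseteq> events" for i
    using meas by (auto split: option.split sum.split)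
  fix A :: "('i + 'j) option \<Rightarrow> 'a set" and J
  assume J: "J \<noteq> {}" "finite J" and A: "\<forall>i\<in>J. A i \<in> ?F i"
  define J1 where "J1 = {j. Some (Inl j) \<in> J}"
  define J2 where "J2 = {j. Some (Inr j) \<in> J}"
  have fin: "finite J1" "finite J2"
    unfolding J1_def J2_def using J(2)
    by (auto intro!: finite_inverse_image[of J] inj_onI)
  have J_eq: "J = ({None} \<inter> J) \<union> ((\<lambda>j. Some (Inl j)) ` J1 \<union> (\<lambda>j. Some (Inr j)) ` J2)" (is "_ = ?J")
  proof (rule set_eqI)
    show "i \<in> J \<longleftrightarrow> i \<in> ?J" for i
      by (cases i; cases "the i") (auto simp: J1_def J2_def image_iff)
  qed
  obtain A0' where A0': "A0' \<in> sets S" "None \<in> J \<Longrightarrow> A None = X -` A0' \<inter> space M"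
  proof (cases "None \<in> J")
    case True
    then show ?thesis using bspec[OF A True] that by auto
  qed (use that sets.top in blast)
  \<comment> \<open>The default \<open>space S\<close> makes the first factor 1 when
    \<open>None\<close> is not in \<open>J\<close>, so the three-block formula covers both
    cases.\<close>
  define A0 where "A0 = (if None \<in> J then A0' else space S)"
  have A0: "A0 \<in> sets S" "None \<in> J \<Longrightarrow> A None = X -` A0 \<inter> space M"
     "None \<notin> J \<Longrightarrow> X -` A0 \<inter> space M = space M"
    using A0' measurable_space[OF meas(1)] by (auto simp: A0_def)
  have "\<forall>j\<in>J1. \<exists>B. B \<in> sets borel \<and> A (Some (Inl j)) = Y j -` B \<inter> space M"
  proof
    fix j assume "j \<in> J1"
    then show "\<exists>B. B \<in> sets borel \<and> A (Some (Inl j)) = Y j -` B \<inter> space M"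
      using bspec[OF A, of "Some (Inl j)"] by (auto simp: J1_def)
  qed
  then obtain A1 where A1: "\<And>j. j \<in> J1 \<Longrightarrow> A1 j \<in> sets borel"
      "\<And>j. j \<in> J1 \<Longrightarrow> A (Some (Inl j)) = Y j -` A1 j \<inter> space M" by metis
  have "\<forall>j\<in>J2. \<exists>B. B \<in> sets borel \<and> A (Some (Inr j)) = Z j -` B \<inter> space M"
  proof
    fix j assume "j \<in> J2"
    then show "\<exists>B. B \<in> sets borel \<and> A (Some (Inr j)) = Z j -` B \<inter> space M"
      using bspec[OF A, of "Some (Inr j)"] by (auto simp: J2_def)
  qed
  then obtain A2 where A2: "\<And>j. j \<in> J2 \<Longrightarrow> A2 j \<in> sets borel"
      "\<And>j. j \<in> J2 \<Longrightarrow> A (Some (Inr j)) = Z j -` A2 j \<inter> space M" by metis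
  obtain B1 where B1: "B1 \<in> sets (PiM UNIV (\<lambda>_. borel))"
    "(\<lambda>\<omega> j. Y j \<omega>) -` B1 \<inter> space M = space M \<inter> (\<Inter>j\<in>J1. Y j -` A1 j \<inter> space M)"
    "prob ((\<lambda>\<omega> j. Y j \<omega>) -` B1 \<inter> space M) = (\<Prod>j\<in>J1. prob (Y j -` A1 j \<inter> space M))"
    by (rule indep_vars_vimage_restrict[OF Y fin(1) A1(1)])
  obtain B2 where B2: "B2 \<in> sets (PiM UNIV (\<lambda>_. borel))"
    "(\<lambda>\<omega> j. Z j \<omega>) -` B2 \<inter> space M = space M \<inter> (\<Inter>j\<in>J2. Z j -` A2 j \<inter> space M)"
    "prob ((\<lambda>\<omega> j. Z j \<omega>) -` B2 \<inter> space M) = (\<Prod>j\<in>J2. prob (Z j -` A2 j \<inter> space M))"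
    by (rule indep_vars_vimage_restrict[OF Z fin(2) A2(1)])
  have sub: "A i \<subseteq> space M" if "i \<in> J" for i
    using bspec[OF A that] by (auto split: option.splits sum.splits)
  have A_None: "(\<Inter>i\<in>{None} \<inter> J. A i) \<inter> space M = X -` A0 \<inter> space M"
    using A0(2,3) by (cases "None \<in> J") auto
  have "(\<Inter>i\<in>J. A i) = (\<Inter>i\<in>J. A i) \<inter> space M"
    using J(1) sub by blast
  also have "\<dots> = ((\<Inter>i\<in>{None} \<inter> J. A i) \<inter> space M) \<inter> (space M \<inter> (\<Inter>j\<in>J1. A (Some (Inl j))))
      \<inter> (space M \<inter> (\<Inter>j\<in>J2. A (Some (Inr j))))"
    by (subst J_eq) (auto simp del: INT_simps)
  also have "\<dots> = (X -` A0 \<inter> space M) \<inter> ((\<lambda>\<omega> j. Y j \<omega>) -` B1 \<inter> space M) \<inter> ((\<lambda>\<omega> j. Z j \<omega>) -` B2 \<inter> space M)"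
    unfolding A_None B1(2) B2(2) using A1(2) A2(2) by simp
  finally have "prob (\<Inter>i\<in>J. A i) = prob (X -` A0 \<inter> space M)
      * prob ((\<lambda>\<omega> j. Y j \<omega>) -` B1 \<inter> space M) * prob ((\<lambda>\<omega> j. Z j \<omega>) -` B2 \<inter> space M)"
    by (simp only: indep_vars3_prob[OF indep A0(1) B1(1) B2(1)])
  also have "\<dots> = (\<Prod>i\<in>{None} \<inter> J. prob (A i)) * ((\<Prod>j\<in>J1. prob (A (Some (Inl j)))) *
      (\<Prod>j\<in>J2. prob (A (Some (Inr j)))))"
    unfolding B1(3) B2(3) using A0(2,3) A1(2) A2(2) by (cases "None \<in> J") (auto simp: prob_space)
  also have "\<dots> = (\<Prod>i\<in>J. prob (A i))"
  proof -
    have "(\<Prod>i\<in>J. prob (A i)) = (\<Prod>i\<in>?J. prob (A i))"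
      using J_eq by (rule arg_cong)
    also have "\<dots> = (\<Prod>i\<in>{None} \<inter> J. prob (A i)) * ((\<Prod>j\<in>J1. prob (A (Some (Inl j)))) *
      (\<Prod>j\<in>J2. prob (A (Some (Inr j)))))"
      using fin by (subst prod.union_disjoint; (subst prod.union_disjoint)?)
        (auto simp: prod.reindex inj_on_def)
    finally show ?thesis by simp
  qed
  finally show "prob (\<Inter>i\<in>J. A i) = (\<Prod>i\<in>J. prob (A i))" .
qed

text \<open>By induction \<open>x k\<close> is a measurable function of \<open>x 0\<close> and the
  noise with index below \<open>k\<close>. Disjoint groups of an independent family are independent,
  and the noise with index \<open>k\<close> lies outside the group read by
  \<open>x k\<close>.\<close>

lemma recursion_independent:
  fixes x Z :: "nat \<Rightarrow> 'a \<Rightarrow> 'b::second_countable_topology"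
    and Y :: "nat \<Rightarrow> 'a \<Rightarrow> 'c::second_countable_topology"
  assumes Y: "indep_vars (\<lambda>_. borel) Y UNIV" and Z: "indep_vars (\<lambda>_. borel) Z UNIV"
    and indep: "indep_vars3 M borel (x 0) (PiM UNIV (\<lambda>_. borel)) (\<lambda>\<omega> j. Y j \<omega>)
      (PiM UNIV (\<lambda>_. borel)) (\<lambda>\<omega> j. Z j \<omega>)"
    and h: "\<And>k. (\<lambda>((a, b), c). h k a b c) \<in> borel_measurable ((borel \<Otimes>\<^sub>M borel) \<Otimes>\<^sub>M borel)"
    and x: "\<And>k \<omega>. \<omega> \<in> space M \<Longrightarrow> x (Suc k) \<omega> = h k (x k \<omega>) (Z k \<omega>) (Y k \<omega>)"
  shows "random_variable borel (x k)"
    and "distr M (borel \<Otimes>\<^sub>M borel) (\<lambda>\<omega>. (x k \<omega>, Z k \<omega>)) = distr M borel (x k) \<Otimes>\<^sub>M distr M borel (Z k)"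
    and "distr M ((borel \<Otimes>\<^sub>M borel) \<Otimes>\<^sub>M borel) (\<lambda>\<omega>. ((x k \<omega>, Z k \<omega>), Y k \<omega>)) =
      distr M (borel \<Otimes>\<^sub>M borel) (\<lambda>\<omega>. (x k \<omega>, Z k \<omega>)) \<Otimes>\<^sub>M distr M borel (Y k)"
proof -
  let ?N = "borel \<Otimes>\<^sub>M borel :: ('b \<times> 'c) measure"
  \<comment> \<open>\<open>indep_vars\<close> needs one value type, so all inputs are coded as pairs with a dummy component.\<close>
  define W where "W i \<omega> = (case i of None \<Rightarrow> (x 0 \<omega>, undefined)
    | Some (Inl j) \<Rightarrow> (undefined, Y j \<omega>) | Some (Inr j) \<Rightarrow> (Z j \<omega>, undefined))" for i \<omega>
  have [measurable]: "random_variable borel (x 0)" "\<And>j. random_variable borel (Y j)" "\<And>j. random_variable borel (Z j)"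
    using indep Y Z by (auto simp: indep_vars3_def indep_vars_def)
  have W: "indep_vars (\<lambda>_. ?N) W UNIV"
    unfolding indep_vars_def2
  proof (intro conjI ballI)
    show "random_variable ?N (W i)" for i
      unfolding W_def by (cases i; cases "the i") simp_all
    show "indep_sets (\<lambda>i. {W i -` A \<inter> space M |A. A \<in> sets ?N}) UNIV"
    proof (rule indep_sets_mono_sets[OF indep_vars3_merge[OF Y Z indep]], rule subsetI)
      fix i E assume "E \<in> {W i -` A \<inter> space M |A. A \<in> sets ?N}"
      then obtain A where A[measurable]: "A \<in> sets ?N" and E: "E = W i -` A \<inter> space M" by auto
      \<comment> \<open>A coded variable has one constant component, so a preimage of
        \<open>A\<close> is a preimage of the section of \<open>A\<close> at that constant.\<close>
      define A1 where "A1 = (\<lambda>a::'b. (a, undefined :: 'c)) -` A"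
      define A2 where "A2 = (\<lambda>c::'c. (undefined :: 'b, c)) -` A"
      have "A1 \<in> sets borel"
        using measurable_sets[OF _ A, of "\<lambda>a. (a, undefined)" borel] by (simp add: A1_def)
      moreover have "A2 \<in> sets borel"
        using measurable_sets[OF _ A, of "\<lambda>c. (undefined, c)" borel] by (simp add: A2_def)
      moreover have "W None -` A \<inter> space M = x 0 -` A1 \<inter> space M"
        "W (Some (Inl j)) -` A \<inter> space M = Y j -` A2 \<inter> space M"
        "W (Some (Inr j)) -` A \<inter> space M = Z j -` A1 \<inter> space M" for j
        unfolding W_def A1_def A2_def by auto
      ultimately show "E \<in> (case i of None \<Rightarrow> {x 0 -` A \<inter> space M | A. A \<in> sets borel}
      | Some (Inl j) \<Rightarrow> {Y j -` A \<inter> space M | A. A \<in> sets borel}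
      | Some (Inr j) \<Rightarrow> {Z j -` A \<inter> space M | A. A \<in> sets borel})"
        unfolding E by (auto split: option.split sum.split)
    qed
  qed
  \<comment> \<open>The bounds are strict: \<open>x k\<close> reads the noise only up to index
    \<open>k - 1\<close>, which keeps both codes of index \<open>k\<close> outside
    \<open>past k\<close>.\<close>
  define past :: "nat \<Rightarrow> (nat + nat) option set"
    where "past k = {None} \<union> (\<lambda>j. Some (Inl j)) ` {..<k} \<union> (\<lambda>j. Some (Inr j)) ` {..<k}" for k
  have "\<exists>g. g \<in> measurable (PiM (past k) (\<lambda>_. ?N)) borel \<and>
    (\<forall>\<omega>\<in>space M. x k \<omega> = g (restrict (\<lambda>i. W i \<omega>) (past k)))" for k
  proof (induction k)
    case 0
    have "(\<lambda>w. fst (w None)) \<in> measurable (PiM (past 0) (\<lambda>_. ?N)) borel"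
      unfolding past_def by measurable
    then show ?case
      by (intro exI[of _ "\<lambda>w. fst (w None)"]) (auto simp: W_def past_def)
  next
    case (Suc k)
    then obtain g where g: "g \<in> measurable (PiM (past k) (\<lambda>_. ?N)) borel"
      and xk: "\<And>\<omega>. \<omega> \<in> space M \<Longrightarrow> x k \<omega> = g (restrict (\<lambda>i. W i \<omega>) (past k))" by blast
    have sub: "past k \<subseteq> past (Suc k)" and mem: "Some (Inl k) \<in> past (Suc k)" "Some (Inr k) \<in> past (Suc k)"
      by (auto simp: past_def)
    let ?g = "\<lambda>w. h k (g (restrict w (past k))) (fst (w (Some (Inr k)))) (snd (w (Some (Inl k))))"
    have [measurable]: "(\<lambda>w. g (restrict w (past k))) \<in> measurable (PiM (past (Suc k)) (\<lambda>_. ?N)) borel"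
      using measurable_compose[OF measurable_restrict_subset[OF sub] g] .
    have [measurable]: "(\<lambda>w. w (Some (Inr k))) \<in> measurable (PiM (past (Suc k)) (\<lambda>_. ?N)) ?N"
      "(\<lambda>w. w (Some (Inl k))) \<in> measurable (PiM (past (Suc k)) (\<lambda>_. ?N)) ?N"
      using mem by measurable
    have "?g \<in> measurable (PiM (past (Suc k)) (\<lambda>_. ?N)) borel"
      using measurable_compose[OF _ h[of k], of "\<lambda>w. ((g (restrict w (past k)), fst (w (Some (Inr k)))), snd (w (Some (Inl k))))"
          "PiM (past (Suc k)) (\<lambda>_. ?N)"]
      by simp
    moreover have "x (Suc k) \<omega> = ?g (restrict (\<lambda>i. W i \<omega>) (past (Suc k)))" if "\<omega> \<in> space M" for \<omega>
      using sub mem that by (simp add: x xk W_def Int_absorb1 inf.absorb2)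
    ultimately show ?case by blast
  qed
  then obtain g where g[measurable]: "\<And>k. g k \<in> measurable (PiM (past k) (\<lambda>_. ?N)) borel"
    and xk: "\<And>k \<omega>. \<omega> \<in> space M \<Longrightarrow> x k \<omega> = g k (restrict (\<lambda>i. W i \<omega>) (past k))" by metis
  have WZ: "fst (W (Some (Inr k)) \<omega>) = Z k \<omega>" and WY: "snd (W (Some (Inl k)) \<omega>) = Y k \<omega>" for \<omega>
    by (simp_all add: W_def)
  have W_meas: "random_variable ?N (W i)" for i
    using W by (auto simp: indep_vars_def)
  have "(\<lambda>\<omega>. g k (restrict (\<lambda>i. W i \<omega>) (past k))) \<in> measurable M borel"
    by (intro measurable_compose[OF measurable_restrict g] W_meas)
  then show "random_variable borel (x k)"
    by (subst measurable_cong[OF xk])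
  have "distr M (borel \<Otimes>\<^sub>M borel) (\<lambda>\<omega>. (g k (restrict (\<lambda>i. W i \<omega>) (past k)), fst (restrict (\<lambda>i. W i \<omega>) {Some (Inr k)} (Some (Inr k))))) =
      distr M borel (\<lambda>\<omega>. g k (restrict (\<lambda>i. W i \<omega>) (past k))) \<Otimes>\<^sub>M
      distr M borel (\<lambda>\<omega>. fst (restrict (\<lambda>i. W i \<omega>) {Some (Inr k)} (Some (Inr k))))"
  proof (rule joint_distr_compose[OF indep_var_restrict[OF W]])
    show "past k \<inter> {Some (Inr k)} = {}" by (auto simp: past_def)
    show "(\<lambda>w. fst (w (Some (Inr k)))) \<in> borel_measurable (Pi\<^sub>M {Some (Inr k)} (\<lambda>_. ?N))"
      by measurable
  qed auto
  then show "distr M (borel \<Otimes>\<^sub>M borel) (\<lambda>\<omega>. (x k \<omega>, Z k \<omega>)) = distr M borel (x k) \<Otimes>\<^sub>M distr M borel (Z k)"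
    by (simp add: xk WZ cong: distr_cong)
  \<comment> \<open>The pair \<open>(x k, Z k)\<close> reads \<open>past k\<close> and the code of
    \<open>Z k\<close>; the code of \<open>Y k\<close> is still unread.\<close>
  let ?I = "insert (Some (Inr k)) (past k)"
  have "distr M ((borel \<Otimes>\<^sub>M borel) \<Otimes>\<^sub>M borel) (\<lambda>\<omega>. ((\<lambda>w. (g k (restrict w (past k)), fst (w (Some (Inr k))))) (restrict (\<lambda>i. W i \<omega>) ?I),
        snd (restrict (\<lambda>i. W i \<omega>) {Some (Inl k)} (Some (Inl k))))) =
      distr M (borel \<Otimes>\<^sub>M borel) (\<lambda>\<omega>. (\<lambda>w. (g k (restrict w (past k)), fst (w (Some (Inr k))))) (restrict (\<lambda>i. W i \<omega>) ?I)) \<Otimes>\<^sub>M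
      distr M borel (\<lambda>\<omega>. snd (restrict (\<lambda>i. W i \<omega>) {Some (Inl k)} (Some (Inl k))))"
  proof (rule joint_distr_compose[OF indep_var_restrict[OF W]])
    show "?I \<inter> {Some (Inl k)} = {}" by (auto simp: past_def)
    have [measurable]: "(\<lambda>w. g k (restrict w (past k))) \<in> measurable (PiM ?I (\<lambda>_. ?N)) borel"
      by (rule measurable_compose[OF measurable_restrict_subset g]) auto
    show "(\<lambda>w. (g k (restrict w (past k)), fst (w (Some (Inr k))))) \<in> measurable (PiM ?I (\<lambda>_. ?N)) (borel \<Otimes>\<^sub>M borel)"
      by measurable
    show "(\<lambda>w. snd (w (Some (Inl k)))) \<in> borel_measurable (Pi\<^sub>M {Some (Inl k)} (\<lambda>_. ?N))"
      by measurable
  qed auto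
  then show "distr M ((borel \<Otimes>\<^sub>M borel) \<Otimes>\<^sub>M borel) (\<lambda>\<omega>. ((x k \<omega>, Z k \<omega>), Y k \<omega>)) =
      distr M (borel \<Otimes>\<^sub>M borel) (\<lambda>\<omega>. (x k \<omega>, Z k \<omega>)) \<Otimes>\<^sub>M distr M borel (Y k)"
    by (simp add: xk WZ WY Int_absorb1 inf.absorb2 subset_insertI cong: distr_cong)
qed

end

section \<open>Uniform distributions on balls and variational inequalities\<close>

text \<open>With a real-valued density, the difference of two such means becomes one integral
  against a difference of densities.\<close>

lemma integral_uniform_measure_cball:
  fixes g :: "'a::euclidean_space \<Rightarrow> 'b::{banach, second_countable_topology}"
  assumes r: "0 < r" and g[measurable]: "g \<in> borel_measurable borel"
  shows "(\<integral>x. g x \<partial>uniform_measure lborel (cball 0 r)) =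
    (\<integral>x. (indicator (cball 0 r) x / measure lborel (cball (0::'a) r)) *\<^sub>R g x \<partial>lborel)"
proof -
  have pos: "0 < measure lborel (cball (0::'a) r)"
    using r by simp
  have [measurable]: "cball (0::'a) r \<in> sets borel"
    by simp
  have "uniform_measure lborel (cball (0::'a) r) =
      density lborel (\<lambda>x. ennreal (indicator (cball 0 r) x / measure lborel (cball (0::'a) r)))"
    unfolding uniform_measure_def
  proof (rule density_cong)
    show "AE x in lborel. indicator (cball (0::'a) r) x / emeasure lborel (cball (0::'a) r) =
        ennreal (indicator (cball 0 r) x / measure lborel (cball (0::'a) r))"
    proof (rule AE_I2)
      fix x :: 'a
      have "emeasure lborel (cball (0::'a) r) = ennreal (measure lborel (cball (0::'a) r))"
        using r by (simp add: emeasure_cball content_cball)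
      then show "indicator (cball 0 r) x / emeasure lborel (cball (0::'a) r) =
          ennreal (indicator (cball 0 r) x / measure lborel (cball (0::'a) r))"
        using pos by (simp add: divide_ennreal[symmetric] ennreal_indicator)
    qed
  qed measurable
  then show ?thesis
    using pos by (simp add: integral_density)
qed

text \<open>The densities of the two balls have L1 distance 2 (1 - V(r)/V(R)) = 2 (1 - (r/R)^n), and
  Bernoulli's inequality bounds 1 - (r/R)^n by n (1 - r/R).\<close>

lemma uniform_cball_mean_diff:
  fixes g :: "'a::euclidean_space \<Rightarrow> 'b::{banach, second_countable_topology}"
  assumes r: "0 < r" "r \<le> R" and g[measurable]: "g \<in> borel_measurable borel"
    and bound: "\<And>x. norm (g x) \<le> C"
  shows "norm ((\<integral>x. g x \<partial>uniform_measure lborel (cball 0 R)) - (\<integral>x. g x \<partial>uniform_measure lborel (cball 0 r)))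
    \<le> 2 * real DIM('a) * C * (1 - r / R)"
proof -
  let ?V = "\<lambda>\<rho>. measure lborel (cball (0::'a) \<rho>)"
  let ?d = "\<lambda>\<rho> x. indicator (cball (0::'a) \<rho>) x / ?V \<rho> :: real"
  have R: "0 < R" using r by simp
  have V: "0 < ?V r" "?V r \<le> ?V R" "0 < ?V R"
    using r R by (auto simp: content_cball intro!: mult_left_mono power_mono)
  have C: "0 \<le> C" using order_trans[OF norm_ge_zero bound] .
  have [measurable]: "cball (0::'a) \<rho> \<in> sets borel" for \<rho>
    by simp
  have ind: "integrable lborel (\<lambda>x. indicator (cball (0::'a) \<rho>) x :: real)" for \<rho>
    using emeasure_bounded_finite[of "cball (0::'a) \<rho>"]
    by (intro integrable_real_indicator) simp_all
  have d: "integrable lborel (?d \<rho>)" for \<rho>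
    using ind by (rule integrable_divide_zero)
  have dg: "integrable lborel (\<lambda>x. ?d \<rho> x *\<^sub>R g x)" for \<rho>
  proof (rule Bochner_Integration.integrable_bound[OF integrable_mult_right[OF d[of \<rho>], of C]])
    show "AE x in lborel. norm (?d \<rho> x *\<^sub>R g x) \<le> norm (C * ?d \<rho> x)"
      using bound C by (auto intro!: AE_I2 mult_mono divide_right_mono simp: mult.commute[of C] abs_mult)
  qed measurable
  \<comment> \<open>The smaller ball carries the larger density. The difference thus changes sign on
    \<open>cball 0 r\<close>, which a correction of \<open>?d R\<close> on that ball accounts
    for.\<close>
  have abs_diff: "\<bar>?d R x - ?d r x\<bar> = ?d R x + (1 / ?V r - 2 / ?V R) * indicator (cball 0 r) x" for x
  proof (cases "x \<in> cball 0 r")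
    case True
    then have "x \<in> cball 0 R" using r by auto
    moreover have "1 / ?V R \<le> 1 / ?V r" using V by (simp add: field_simps)
    ultimately show ?thesis using True by simp
  qed (use V in simp)
  have "norm ((\<integral>x. g x \<partial>uniform_measure lborel (cball 0 R)) - (\<integral>x. g x \<partial>uniform_measure lborel (cball 0 r)))
    = norm (\<integral>x. (?d R x - ?d r x) *\<^sub>R g x \<partial>lborel)"
    using dg[of R] dg[of r]
    by (simp add: integral_uniform_measure_cball[OF _ g] r R scaleR_diff_left)
  also have "\<dots> \<le> (\<integral>x. norm ((?d R x - ?d r x) *\<^sub>R g x) \<partial>lborel)"
    by (rule integral_norm_bound)
  also have "\<dots> \<le> (\<integral>x. C * \<bar>?d R x - ?d r x\<bar> \<partial>lborel)"
  proof (rule integral_mono)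
    show "integrable lborel (\<lambda>x. norm ((?d R x - ?d r x) *\<^sub>R g x))"
      using dg[of R] dg[of r] unfolding scaleR_diff_left by (intro integrable_norm Bochner_Integration.integrable_diff)
    show "integrable lborel (\<lambda>x. C * \<bar>?d R x - ?d r x\<bar>)"
      using d[of R] d[of r] by (intro integrable_mult_right integrable_abs Bochner_Integration.integrable_diff)
  qed (use bound C in \<open>auto intro!: mult_mono simp: mult.commute[of C]\<close>)
  also have "\<dots> = C * (?V R / ?V R + (1 / ?V r - 2 / ?V R) * ?V r)"
    unfolding abs_diff using d[of R] ind[of r] ind[of R] by simp
  also have "\<dots> = 2 * C * (1 - ?V r / ?V R)"
    using V by (simp add: field_simps)
  also have "?V r / ?V R = (r / R) ^ DIM('a)"
    using r R by (simp add: content_cball power_divide unit_ball_vol_pos less_imp_neq[symmetric])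
  also have "2 * C * (1 - (r / R) ^ DIM('a)) \<le> 2 * C * (real DIM('a) * (1 - r / R))"
    using Bernoulli_inequality[of "r / R - 1" "DIM('a)"] r R C
    by (intro mult_left_mono) (auto simp: algebra_simps)
  finally show ?thesis by (simp add: mult_ac)
qed

lemma uniform_cball_mean_diff_minmax:
  fixes g :: "'a::euclidean_space \<Rightarrow> 'b::{banach, second_countable_topology}"
  assumes "0 < r" "0 < R" and "g \<in> borel_measurable borel" and "\<And>x. norm (g x) \<le> C"
  shows "norm ((\<integral>x. g x \<partial>uniform_measure lborel (cball 0 R)) - (\<integral>x. g x \<partial>uniform_measure lborel (cball 0 r)))
    \<le> 2 * real DIM('a) * C * (1 - min R r / max R r)"
  using uniform_cball_mean_diff[of r R g C] uniform_cball_mean_diff[of R r g C] assms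
  by (cases "r \<le> R") (auto simp: norm_minus_commute min_def max_def)

text \<open>Each inequality is tested at the other solution and the two are added. Monotonicity of
  \<open>G'\<close> removes its increment, leaving b' |s - s'|^2 against the perturbation of the map
  at the single point \<open>s\<close>.\<close>

lemma regularized_VI_drift:
  fixes G G' :: "'a::real_inner \<Rightarrow> 'a"
  assumes s: "s \<in> VI_solutions X (\<lambda>y. G y + b *\<^sub>R y)"
    and s': "s' \<in> VI_solutions X (\<lambda>y. G' y + b' *\<^sub>R y)"
    and mono: "monotone_map_on X G'" and b': "0 < b'"
  shows "norm (s - s') \<le> norm (G s - G' s) / b' + norm s * \<bar>1 - b / b'\<bar>"
proof -
  have sX: "s \<in> X" "s' \<in> X" using s s' by (auto simp: VI_solutions_def)
  have "(G s + b *\<^sub>R s) \<bullet> (s' - s) \<ge> 0" "(G' s' + b' *\<^sub>R s') \<bullet> (s - s') \<ge> 0"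
    using s s' sX by (auto simp: VI_solutions_def)
  moreover have "(G' s - G' s') \<bullet> (s - s') \<ge> 0"
    using mono sX by (auto simp: monotone_map_on_def)
  ultimately have "b' * ((s - s') \<bullet> (s - s')) \<le> (G' s - G s + (b' - b) *\<^sub>R s) \<bullet> (s - s')"
    by (simp add: algebra_simps inner_commute)
  also have "\<dots> \<le> norm (G' s - G s + (b' - b) *\<^sub>R s) * norm (s - s')"
    by (rule norm_cauchy_schwarz)
  also have "\<dots> \<le> (norm (G s - G' s) + \<bar>b' - b\<bar> * norm s) * norm (s - s')"
    using norm_triangle_ineq[of "G' s - G s" "(b' - b) *\<^sub>R s"]
    by (intro mult_right_mono) (auto simp: norm_minus_commute)
  finally have *: "(b' * norm (s - s')) * norm (s - s') \<le> (norm (G s - G' s) + \<bar>b' - b\<bar> * norm s) * norm (s - s')"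
    by (simp add: power2_norm_eq_inner[symmetric] power2_eq_square mult_ac)
  then have "b' * norm (s - s') \<le> norm (G s - G' s) + \<bar>b' - b\<bar> * norm s"
  proof (cases "s = s'")
    case False
    then have "0 < norm (s - s')" by simp
    with * show ?thesis
      by (rule mult_right_le_imp_le)
  qed simp
  then have "norm (s - s') \<le> (norm (G s - G' s) + \<bar>b' - b\<bar> * norm s) / b'"
    using b' by (simp add: field_simps)
  also have "\<dots> = norm (G s - G' s) / b' + norm s * \<bar>1 - b / b'\<bar>"
  proof -
    have "1 - b / b' = (b' - b) / b'" using b' by (simp add: field_simps)
    then show ?thesis using b' by (simp add: add_divide_distrib abs_divide)
  qed
  finally show ?thesis .
qed

section \<open>One step of the scheme\<close>

context prob_space
begin

text \<open>The pointwise bound |f| <= (|f|^2 / C + C) / 2 yields integrability and the constant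
  \<open>C\<close> at once.\<close>

lemma expectation_norm_le:
  fixes f :: "'a \<Rightarrow> 'b::{banach, second_countable_topology}"
  assumes f[measurable]: "f \<in> borel_measurable M" and C: "0 < C"
    and int: "integrable M (\<lambda>\<omega>. (norm (f \<omega>))\<^sup>2)" and bound: "(\<integral>\<omega>. (norm (f \<omega>))\<^sup>2 \<partial>M) \<le> C\<^sup>2"
  shows "integrable M f" and "norm (\<integral>\<omega>. f \<omega> \<partial>M) \<le> C"
proof -
  have le: "norm (f \<omega>) \<le> ((norm (f \<omega>))\<^sup>2 / C + C) / 2" for \<omega>
    using C zero_le_power2[of "norm (f \<omega>) - C"]
    by (simp add: field_simps power2_eq_square)
  have int': "integrable M (\<lambda>\<omega>. ((norm (f \<omega>))\<^sup>2 / C + C) / 2)"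
    using int by simp
  then show "integrable M f"
    using le C by (rule_tac Bochner_Integration.integrable_bound) (auto intro!: AE_I2 order_trans[OF _ abs_ge_self])
  then have "norm (\<integral>\<omega>. f \<omega> \<partial>M) \<le> (\<integral>\<omega>. ((norm (f \<omega>))\<^sup>2 / C + C) / 2 \<partial>M)"
    using int' le by (intro order_trans[OF integral_norm_bound] integral_mono) auto
  also have "\<dots> = ((\<integral>\<omega>. (norm (f \<omega>))\<^sup>2 \<partial>M) / C + C) / 2"
    using int by (simp add: prob_space)
  also have "\<dots> \<le> (C\<^sup>2 / C + C) / 2"
    using C bound by (intro divide_right_mono add_right_mono) auto
  also have "\<dots> = C"
    using C by (simp add: power2_eq_square)
  finally show "norm (\<integral>\<omega>. f \<omega> \<partial>M) \<le> C" .
qed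

text \<open>The regularisation is split as eta x = eta (x - s) + eta s. The first part produces the
  contraction 2 eta gamma; the second is compensated by the variational inequality of
  \<open>s\<close> tested at \<open>x\<close>, up to the monotonicity inequality between
  \<open>s + z\<close> and \<open>x + z\<close>.\<close>

lemma projected_step_expectation:
  fixes x z :: "'a \<Rightarrow> 'b::euclidean_space" and y \<xi> :: "'a \<Rightarrow> 'c::second_countable_topology"
    and \<Phi> :: "'b \<Rightarrow> 'c \<Rightarrow> 'b" and F :: "'b \<Rightarrow> 'b"
  assumes X: "closed X" "convex X" and M: "\<And>v. v \<in> X \<Longrightarrow> norm v \<le> R"
    and rv[measurable]: "random_variable borel x" "random_variable borel z" "random_variable borel y"
      "random_variable borel \<xi>"
    and xX: "\<And>\<omega>. \<omega> \<in> space M \<Longrightarrow> x \<omega> \<in> X"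
    and dom: "\<And>\<omega>. \<omega> \<in> space M \<Longrightarrow> x \<omega> + z \<omega> \<in> E" "\<And>\<omega>. \<omega> \<in> space M \<Longrightarrow> s + z \<omega> \<in> E"
    and \<Phi>: "(\<lambda>(u, w). \<Phi> u w) \<in> borel_measurable (borel \<Otimes>\<^sub>M borel)"
    and C: "0 < C" "\<And>u. integrable M (\<lambda>\<omega>. (norm (\<Phi> u (\<xi> \<omega>)))\<^sup>2)"
      "\<And>u. (\<integral>\<omega>. (norm (\<Phi> u (\<xi> \<omega>)))\<^sup>2 \<partial>M) \<le> C\<^sup>2"
    and F: "\<And>u. F u = (\<integral>\<omega>. \<Phi> u (\<xi> \<omega>) \<partial>M)" and F_meas[measurable]: "F \<in> borel_measurable borel"
    and mono: "monotone_map_on E F"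
    and y: "distr M borel y = distr M borel \<xi>"
    and indep_xz: "distr M (borel \<Otimes>\<^sub>M borel) (\<lambda>\<omega>. (x \<omega>, z \<omega>)) = distr M borel x \<Otimes>\<^sub>M distr M borel z"
    and indep_y: "distr M ((borel \<Otimes>\<^sub>M borel) \<Otimes>\<^sub>M borel) (\<lambda>\<omega>. ((x \<omega>, z \<omega>), y \<omega>)) =
      distr M (borel \<Otimes>\<^sub>M borel) (\<lambda>\<omega>. (x \<omega>, z \<omega>)) \<Otimes>\<^sub>M distr M borel y"
    and s: "s \<in> VI_solutions X (\<lambda>v. smoothed_map M z F v + \<eta> *\<^sub>R v)"
    and pos: "0 < \<gamma>" "0 < \<eta>"
    and x': "\<And>\<omega>. \<omega> \<in> space M \<Longrightarrow> x' \<omega> = closest_point X (x \<omega> - \<gamma> *\<^sub>R (\<Phi> (x \<omega> + z \<omega>) (y \<omega>) + \<eta> *\<^sub>R x \<omega>))"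
    and x'_int: "integrable M (\<lambda>\<omega>. (norm (x' \<omega> - s))\<^sup>2)"
  shows "(\<integral>\<omega>. (norm (x' \<omega> - s))\<^sup>2 \<partial>M) \<le>
    (1 - 2 * (\<eta> * \<gamma>)) * (\<integral>\<omega>. (norm (x \<omega> - s))\<^sup>2 \<partial>M) + \<gamma>\<^sup>2 * (2 * C\<^sup>2 + 2 * \<eta>\<^sup>2 * R\<^sup>2)"
proof -
  have sX: "s \<in> X" using s by (simp add: VI_solutions_def)
  have d_le: "norm (x \<omega> - s) \<le> 2 * R" if "\<omega> \<in> space M" for \<omega>
    using norm_triangle_ineq4[of "x \<omega>" s] M[OF sX] M[OF xX[OF that]] by simp
  have [measurable]: "(\<lambda>\<omega>. \<Phi> (f \<omega>) (g \<omega>)) \<in> borel_measurable N"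
    if "f \<in> borel_measurable N" "g \<in> borel_measurable N" for f g and N :: "'z measure"
    using measurable_compose[OF measurable_Pair[OF that] \<Phi>] by simp
  define \<phi> where "\<phi> \<omega> = \<Phi> (x \<omega> + z \<omega>) (y \<omega>)" for \<omega>
  have \<phi>[measurable]: "\<phi> \<in> borel_measurable M"
    unfolding \<phi>_def by measurable
  have \<Phi>_shift[measurable]: "(\<lambda>p. \<Phi> (fst (fst p) + snd (fst p)) (snd p)) \<in>
      borel_measurable ((borel \<Otimes>\<^sub>M borel) \<Otimes>\<^sub>M borel)"
    by measurable
  \<comment> \<open>Integrability of the squared norm is not yet known, so independence is first
    applied to the nonnegative integral, which always makes sense.\<close>
  have "(\<integral>\<^sup>+\<omega>. ennreal ((norm (\<phi> \<omega>))\<^sup>2) \<partial>M) =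
      (\<integral>\<^sup>+\<omega>. \<integral>\<^sup>+\<omega>'. ennreal ((norm (\<Phi> (x \<omega> + z \<omega>) (\<xi> \<omega>')))\<^sup>2) \<partial>M \<partial>M)"
    using nn_integral_independent[OF _ _ _ indep_y y, of "\<lambda>p. ennreal ((norm (\<Phi> (fst (fst p) + snd (fst p)) (snd p)))\<^sup>2)"]
    by (simp add: \<phi>_def)
  also have "\<dots> \<le> (\<integral>\<^sup>+\<omega>. ennreal (C\<^sup>2) \<partial>M)"
    using C by (intro nn_integral_mono) (simp add: nn_integral_eq_integral ennreal_leI)
  also have "\<dots> = ennreal (C\<^sup>2)"
    by (simp add: emeasure_space_1)
  finally have nn: "(\<integral>\<^sup>+\<omega>. ennreal ((norm (\<phi> \<omega>))\<^sup>2) \<partial>M) \<le> ennreal (C\<^sup>2)" .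
  then have \<phi>2_int: "integrable M (\<lambda>\<omega>. (norm (\<phi> \<omega>))\<^sup>2)"
    by (intro integrableI_bounded) (auto intro: le_less_trans)
  have \<phi>2: "(\<integral>\<omega>. (norm (\<phi> \<omega>))\<^sup>2 \<partial>M) \<le> C\<^sup>2"
    using nn nn_integral_eq_integral[OF \<phi>2_int] by simp
  have \<phi>_int: "integrable M \<phi>"
    by (rule expectation_norm_le[OF \<phi> C(1) \<phi>2_int \<phi>2])
  have \<Phi>_int: "integrable M (\<lambda>\<omega>. \<Phi> u (\<xi> \<omega>))" and F_le: "norm (F u) \<le> C" for u
    unfolding F by (rule expectation_norm_le[OF _ C]; measurable)+
  have R: "0 \<le> R" using order_trans[OF norm_ge_zero M[OF sX]] .
  have d\<phi>_int: "integrable M (\<lambda>\<omega>. (x \<omega> - s) \<bullet> \<phi> \<omega>)"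
  proof (rule Bochner_Integration.integrable_bound[OF integrable_mult_right[OF integrable_norm[OF \<phi>_int], of "2 * R"]])
    show "AE \<omega> in M. norm ((x \<omega> - s) \<bullet> \<phi> \<omega>) \<le> norm (2 * R * norm (\<phi> \<omega>))"
      using d_le R by (intro AE_I2) (auto intro!: order_trans[OF Cauchy_Schwarz_ineq2] mult_right_mono simp: abs_mult)
  qed measurable
  have dF_int: "integrable M (\<lambda>\<omega>. (x \<omega> - s) \<bullet> F (g \<omega>))" if [measurable]: "g \<in> borel_measurable M" for g
  proof (rule integrable_const_bound[of _ "2 * R * C"])
    show "AE \<omega> in M. norm ((x \<omega> - s) \<bullet> F (g \<omega>)) \<le> 2 * R * C"
      using d_le R F_le by (intro AE_I2) (auto intro!: order_trans[OF Cauchy_Schwarz_ineq2] mult_mono)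
  qed measurable
  have d2_int: "integrable M (\<lambda>\<omega>. (norm (x \<omega> - s))\<^sup>2)"
    using power_mono[OF d_le norm_ge_zero, of _ 2]
    by (intro integrable_const_bound[of _ "(2 * R)\<^sup>2"] AE_I2) auto
  have ds_int: "integrable M (\<lambda>\<omega>. (x \<omega> - s) \<bullet> s)"
  proof (rule integrable_const_bound[of _ "2 * R * norm s"])
    show "AE \<omega> in M. norm ((x \<omega> - s) \<bullet> s) \<le> 2 * R * norm s"
      using d_le by (intro AE_I2) (auto intro!: order_trans[OF Cauchy_Schwarz_ineq2] mult_right_mono)
  qed measurable
  \<comment> \<open>The chain passes from the inequality for \<open>s\<close> to
    \<open>F (s + z)\<close> with the same \<open>z\<close> as in the step. Only then do the two
    arguments of \<open>F\<close> differ by exactly \<open>x - s\<close>, as pointwise monotonicity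
    requires.\<close>
  have "- \<eta> * (\<integral>\<omega>. (x \<omega> - s) \<bullet> s \<partial>M) = (\<integral>\<omega>. - \<eta> * ((x \<omega> - s) \<bullet> s) \<partial>M)"
    by simp
  also have "\<dots> \<le> (\<integral>\<omega>. (x \<omega> - s) \<bullet> smoothed_map M z F s \<partial>M)"
  proof (rule integral_mono)
    show "integrable M (\<lambda>\<omega>. (x \<omega> - s) \<bullet> smoothed_map M z F s)"
      using d_le by (intro integrable_const_bound[of _ "2 * R * norm (smoothed_map M z F s)"] AE_I2)
        (auto intro!: order_trans[OF Cauchy_Schwarz_ineq2] mult_right_mono)
    show "- \<eta> * ((x \<omega> - s) \<bullet> s) \<le> (x \<omega> - s) \<bullet> smoothed_map M z F s" if "\<omega> \<in> space M" for \<omega>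
    proof -
      have "0 \<le> (smoothed_map M z F s + \<eta> *\<^sub>R s) \<bullet> (x \<omega> - s)"
        using s xX[OF that] by (auto simp: VI_solutions_def)
      then show ?thesis
        unfolding inner_add_left inner_scaleR_left by (simp add: inner_commute)
    qed
  qed (use ds_int in simp)
  also have "\<dots> = (\<integral>\<omega>. \<integral>\<omega>'. (x \<omega> - s) \<bullet> F (s + z \<omega>') \<partial>M \<partial>M)"
    unfolding smoothed_map_def using F_le
    by (intro Bochner_Integration.integral_cong refl integral_inner_right[symmetric] integrable_const_bound[of _ C]) auto
  also have "\<dots> = (\<integral>\<omega>. (x \<omega> - s) \<bullet> F (s + z \<omega>) \<partial>M)"
    using integral_independent[OF _ _ _ indep_xz refl, of "\<lambda>(a, b). (a - s) \<bullet> F (s + b)"] dF_int[of "\<lambda>\<omega>. s + z \<omega>"]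
    by simp
  also have "\<dots> \<le> (\<integral>\<omega>. (x \<omega> - s) \<bullet> F (x \<omega> + z \<omega>) \<partial>M)"
  proof (intro integral_mono dF_int)
    show "(x \<omega> - s) \<bullet> F (s + z \<omega>) \<le> (x \<omega> - s) \<bullet> F (x \<omega> + z \<omega>)" if "\<omega> \<in> space M" for \<omega>
    proof -
      have "(F (x \<omega> + z \<omega>) - F (s + z \<omega>)) \<bullet> ((x \<omega> + z \<omega>) - (s + z \<omega>)) \<ge> 0"
        using mono dom that unfolding monotone_map_on_def by blast
      then show ?thesis by (simp add: inner_diff_left inner_diff_right inner_commute)
    qed
  qed measurable
  also have "\<dots> = (\<integral>\<omega>. \<integral>\<omega>'. (x \<omega> - s) \<bullet> \<Phi> (x \<omega> + z \<omega>) (\<xi> \<omega>') \<partial>M \<partial>M)"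
    unfolding F by (intro Bochner_Integration.integral_cong refl integral_inner_right[symmetric] \<Phi>_int)
  also have "\<dots> = (\<integral>\<omega>. (x \<omega> - s) \<bullet> \<phi> \<omega> \<partial>M)"
    using integral_independent[OF _ _ _ indep_y y, of "\<lambda>p. (fst (fst p) - s) \<bullet> \<Phi> (fst (fst p) + snd (fst p)) (snd p)"] d\<phi>_int
    by (simp add: \<phi>_def)
  finally have cross: "0 \<le> (\<integral>\<omega>. (x \<omega> - s) \<bullet> \<phi> \<omega> \<partial>M) + \<eta> * (\<integral>\<omega>. (x \<omega> - s) \<bullet> s \<partial>M)"
    by simp
  \<comment> \<open>The cross bracket has no pointwise sign; \<open>cross\<close> controls only its
    expectation, so it is kept here and dropped after integration.\<close>
  have step: "(norm (x' \<omega> - s))\<^sup>2 \<le> (1 - 2 * (\<eta> * \<gamma>)) * (norm (x \<omega> - s))\<^sup>2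
      - 2 * \<gamma> * ((x \<omega> - s) \<bullet> \<phi> \<omega> + \<eta> * ((x \<omega> - s) \<bullet> s)) + \<gamma>\<^sup>2 * (2 * (norm (\<phi> \<omega>))\<^sup>2 + 2 * \<eta>\<^sup>2 * R\<^sup>2)"
    if \<omega>: "\<omega> \<in> space M" for \<omega>
  proof -
    have expand: "(norm (u - \<gamma> *\<^sub>R v))\<^sup>2 = (norm u)\<^sup>2 - 2 * \<gamma> * (u \<bullet> v) + \<gamma>\<^sup>2 * (norm v)\<^sup>2" for u v :: 'b
      unfolding power2_norm_eq_inner inner_diff_left inner_diff_right inner_scaleR_left inner_scaleR_right
      by (simp add: inner_commute power2_eq_square algebra_simps)
    let ?g = "\<phi> \<omega> + \<eta> *\<^sub>R x \<omega>"
    have "norm (x' \<omega> - s) \<le> norm ((x \<omega> - s) - \<gamma> *\<^sub>R ?g)"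
      using closest_point_lipschitz[OF X(2,1), of "x \<omega> - \<gamma> *\<^sub>R ?g" s] sX closest_point_self[OF sX]
      by (auto simp: x'[OF \<omega>] \<phi>_def dist_norm algebra_simps)
    then have "(norm (x' \<omega> - s))\<^sup>2 \<le> (norm ((x \<omega> - s) - \<gamma> *\<^sub>R ?g))\<^sup>2"
      by (rule power_mono) simp
    also have "\<dots> = (norm (x \<omega> - s))\<^sup>2 - 2 * \<gamma> * ((x \<omega> - s) \<bullet> ?g) + \<gamma>\<^sup>2 * (norm ?g)\<^sup>2"
      by (rule expand)
    also have "(x \<omega> - s) \<bullet> ?g = (x \<omega> - s) \<bullet> \<phi> \<omega> + \<eta> * ((norm (x \<omega> - s))\<^sup>2 + (x \<omega> - s) \<bullet> s)"
      by (simp add: power2_norm_eq_inner inner_diff_left inner_diff_right inner_add_right inner_commute algebra_simps)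
    also have "(norm ?g)\<^sup>2 \<le> 2 * (norm (\<phi> \<omega>))\<^sup>2 + 2 * \<eta>\<^sup>2 * R\<^sup>2"
    proof -
      have "norm ?g \<le> norm (\<phi> \<omega>) + \<eta> * R"
        using M[OF xX[OF \<omega>]] pos by (intro order_trans[OF norm_triangle_ineq]) simp
      then have "(norm ?g)\<^sup>2 \<le> (norm (\<phi> \<omega>) + \<eta> * R)\<^sup>2"
        by (rule power_mono) simp
      also have "\<dots> \<le> 2 * (norm (\<phi> \<omega>))\<^sup>2 + 2 * \<eta>\<^sup>2 * R\<^sup>2"
        using zero_le_power2[of "norm (\<phi> \<omega>) - \<eta> * R"] by (simp add: power2_eq_square algebra_simps)
      finally show ?thesis .
    qed
    finally show ?thesis
      using pos by (simp add: algebra_simps mult_left_mono)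
  qed
  have "(\<integral>\<omega>. (norm (x' \<omega> - s))\<^sup>2 \<partial>M) \<le> (\<integral>\<omega>. (1 - 2 * (\<eta> * \<gamma>)) * (norm (x \<omega> - s))\<^sup>2
      - 2 * \<gamma> * ((x \<omega> - s) \<bullet> \<phi> \<omega> + \<eta> * ((x \<omega> - s) \<bullet> s)) + \<gamma>\<^sup>2 * (2 * (norm (\<phi> \<omega>))\<^sup>2 + 2 * \<eta>\<^sup>2 * R\<^sup>2) \<partial>M)"
    using d2_int d\<phi>_int ds_int \<phi>2_int by (intro integral_mono x'_int step) simp_all
  also have "\<dots> = (1 - 2 * (\<eta> * \<gamma>)) * (\<integral>\<omega>. (norm (x \<omega> - s))\<^sup>2 \<partial>M)
      - 2 * \<gamma> * ((\<integral>\<omega>. (x \<omega> - s) \<bullet> \<phi> \<omega> \<partial>M) + \<eta> * (\<integral>\<omega>. (x \<omega> - s) \<bullet> s \<partial>M))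
      + \<gamma>\<^sup>2 * (2 * (\<integral>\<omega>. (norm (\<phi> \<omega>))\<^sup>2 \<partial>M) + 2 * \<eta>\<^sup>2 * R\<^sup>2)"
    using d2_int d\<phi>_int ds_int \<phi>2_int by (simp add: prob_space)
  also have "\<dots> \<le> (1 - 2 * (\<eta> * \<gamma>)) * (\<integral>\<omega>. (norm (x \<omega> - s))\<^sup>2 \<partial>M) - 0
      + \<gamma>\<^sup>2 * (2 * C\<^sup>2 + 2 * \<eta>\<^sup>2 * R\<^sup>2)"
    using cross \<phi>2 pos by (intro add_mono diff_mono mult_left_mono order_refl) auto
  finally show ?thesis by simp
qed

end

section \<open>Scalar recursion and properties of the smoothed maps\<close>

lemma norm_add_power2_le:
  fixes u v :: "'a::real_normed_vector"
  assumes "0 < (t::real)"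
  shows "(norm (u + v))\<^sup>2 \<le> (1 + t) * (norm u)\<^sup>2 + (1 + 1 / t) * (norm v)\<^sup>2"
proof -
  have "0 \<le> (t * norm u - norm v)\<^sup>2 / t"
    using assms by simp
  also have "\<dots> = t * (norm u)\<^sup>2 - 2 * norm u * norm v + (norm v)\<^sup>2 / t"
    using assms by (simp add: power2_eq_square field_simps)
  finally have "(norm u + norm v)\<^sup>2 \<le> (1 + t) * (norm u)\<^sup>2 + (1 + 1 / t) * (norm v)\<^sup>2"
    by (simp add: power2_eq_square algebra_simps)
  with power_mono[OF norm_triangle_ineq norm_ge_zero, of u v 2] show ?thesis
    by (rule order_trans)
qed

text \<open>For q <= 1/2 the product (1 - 2q)(1 + q) is at most 1 - q/2 and at most 1, and (1 + 1/q)
  D = (1 + q) D/q. For q > 1/2 the factor 1 - 2q is negative and b >= 0 suffices. In use,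
  \<open>a'\<close>, \<open>b\<close>, \<open>a\<close> are the mean squares of x_{k+1} - s_k, x_k -
  s_k, x_k - s_{k-1}; \<open>D\<close> is the squared drift, \<open>N\<close> the noise and
  \<open>c\<close> is theta nu_k.\<close>

lemma contraction_with_drift:
  fixes a a' b c D N q :: real
  assumes step: "a' \<le> (1 - 2 * q) * b + N" and b: "0 \<le> b" "b \<le> (1 + q) * a + (1 + 1 / q) * D"
    and a: "0 \<le> a" "a \<le> (1 + \<delta> * q) * c" and c: "0 \<le> c" and D: "0 \<le> D"
    and q: "0 < q" "q < 1" and \<delta>: "0 < \<delta>" "\<delta> < 1 / 2"
  shows "a' \<le> (1 - (1 / 2 - \<delta>) * q) * c + D / q + N"
proof -
  have "(1 - 2 * q) * b \<le> (1 - q / 2) * a + D / q"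
  proof (cases "q \<le> 1 / 2")
    case True
    have "(1 - 2 * q) * b \<le> (1 - 2 * q) * ((1 + q) * a + (1 + 1 / q) * D)"
      using True b by (intro mult_left_mono) auto
    also have "\<dots> = ((1 - 2 * q) * (1 + q)) * a + ((1 - 2 * q) * (1 + q)) * (D / q)"
      using q by (simp add: field_simps)
    also have "\<dots> \<le> (1 - q / 2) * a + 1 * (D / q)"
      using q a D by (intro add_mono mult_right_mono) (auto simp: algebra_simps)
    finally show ?thesis by simp
  next
    case False
    then have "(1 - 2 * q) * b \<le> 0" using b by (simp add: mult_nonpos_nonneg)
    also have "0 \<le> (1 - q / 2) * a + D / q" using q a D by auto
    finally show ?thesis .
  qed
  also have "(1 - q / 2) * a \<le> (1 - q / 2) * ((1 + \<delta> * q) * c)"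
    using q a by (intro mult_left_mono) auto
  also have "\<dots> = ((1 - q / 2) * (1 + \<delta> * q)) * c"
    by simp
  also have "\<dots> \<le> (1 - (1 / 2 - \<delta>) * q) * c"
    using q \<delta> c by (intro mult_right_mono) (auto simp: algebra_simps)
  finally show ?thesis using step by linarith
qed

text \<open>A common shift by \<open>z\<close> cancels in the difference of the arguments, so
  monotonicity survives taking expectations.\<close>

lemma (in prob_space) smoothed_map_monotone:
  fixes F :: "'b::euclidean_space \<Rightarrow> 'b"
  assumes mono: "monotone_map_on E F" and dom: "\<And>v \<omega>. v \<in> X \<Longrightarrow> \<omega> \<in> space M \<Longrightarrow> v + z \<omega> \<in> E"
    and int: "\<And>v. v \<in> X \<Longrightarrow> integrable M (\<lambda>\<omega>. F (v + z \<omega>))"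
  shows "monotone_map_on X (smoothed_map M z F)"
  unfolding monotone_map_on_def
proof (intro ballI)
  fix u v assume uv: "u \<in> X" "v \<in> X"
  have "0 \<le> (\<integral>\<omega>. (F (u + z \<omega>) - F (v + z \<omega>)) \<bullet> (u - v) \<partial>M)"
  proof (rule Bochner_Integration.integral_nonneg)
    fix \<omega> assume "\<omega> \<in> space M"
    then have "(F (u + z \<omega>) - F (v + z \<omega>)) \<bullet> ((u + z \<omega>) - (v + z \<omega>)) \<ge> 0"
      using mono dom uv unfolding monotone_map_on_def by blast
    then show "0 \<le> (F (u + z \<omega>) - F (v + z \<omega>)) \<bullet> (u - v)" by simp
  qed
  also have "\<dots> = (smoothed_map M z F u - smoothed_map M z F v) \<bullet> (u - v)"
    unfolding smoothed_map_def using int uv by simp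
  finally show "0 \<le> (smoothed_map M z F u - smoothed_map M z F v) \<bullet> (u - v)" .
qed

lemma (in prob_space) smoothed_map_uniform_diff:
  fixes F :: "'b::euclidean_space \<Rightarrow> 'b"
  assumes F[measurable]: "F \<in> borel_measurable borel" and bound: "\<And>u. norm (F u) \<le> C"
    and z[measurable]: "random_variable borel z" "random_variable borel z'"
    and unif: "distr M borel z = uniform_measure lborel (cball 0 r)"
      "distr M borel z' = uniform_measure lborel (cball 0 r')"
    and r: "0 < r" "0 < r'"
  shows "norm (smoothed_map M z F v - smoothed_map M z' F v) \<le>
    2 * real DIM('b) * C * (1 - min r r' / max r r')"
proof -
  have "smoothed_map M z F v = (\<integral>u. F (v + u) \<partial>distr M borel z)"
    "smoothed_map M z' F v = (\<integral>u. F (v + u) \<partial>distr M borel z')"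
    unfolding smoothed_map_def by (simp_all add: integral_distr)
  then show ?thesis
    unfolding unif using r bound by (simp add: uniform_cball_mean_diff_minmax)
qed

text \<open>The integrability conjunct excludes that the bound holds through the default value 0 of
  the integral of a non-integrable function. The inclusion of \<open>z k\<close> in its ball holds
  at every sample point, so \<open>x k + z k\<close> never leaves the enlargement.\<close>

theorem proposition2:
  fixes P :: "'w measure"
    and X :: "(real ^ 'n) set"
    and M C \<epsilon> \<delta> \<eta>bar B1 B2 \<theta> :: real
    and \<xi> :: "'w \<Rightarrow> real ^ 'd"
    and \<Phi> :: "real ^ 'n \<Rightarrow> real ^ 'd \<Rightarrow> real ^ 'n"
    and F :: "real ^ 'n \<Rightarrow> real ^ 'n"
    and \<xi>s :: "nat \<Rightarrow> 'w \<Rightarrow> real ^ 'd"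
    and z :: "nat \<Rightarrow> 'w \<Rightarrow> real ^ 'n"
    and x :: "nat \<Rightarrow> 'w \<Rightarrow> real ^ 'n"
    and s :: "nat \<Rightarrow> real ^ 'n"
    and \<gamma> \<eta> \<epsilon>s :: "nat \<Rightarrow> real"
    and K1 K2 K3 Kbar :: nat
  assumes P: "prob_space P"
    and X: "closed X" "bounded X" "convex X"
    and M: "M > 0" "\<And>y. y \<in> X \<Longrightarrow> norm y \<le> M"
    and eps: "\<epsilon> > 0"
    and xi: "\<xi> \<in> borel_measurable P"
    and Phi: "(\<lambda>(y, w). \<Phi> y w) \<in>
      borel_measurable (restrict_space borel (enlargement X \<epsilon>) \<Otimes>\<^sub>M borel)"
    and F: "\<And>y. y \<in> enlargement X \<epsilon> \<Longrightarrow> F y = (\<integral>\<omega>. \<Phi> y (\<xi> \<omega>) \<partial>P)"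
    and F_mono: "monotone_map_on (enlargement X \<epsilon>) F"
    and F_cont: "continuous_on (enlargement X \<epsilon>) F"
    and C: "C > 0"
      "\<And>y. y \<in> enlargement X \<epsilon> \<Longrightarrow> integrable P (\<lambda>\<omega>. (norm (\<Phi> y (\<xi> \<omega>)))\<^sup>2)"
      "\<And>y. y \<in> enlargement X \<epsilon> \<Longrightarrow> (\<integral>\<omega>. (norm (\<Phi> y (\<xi> \<omega>)))\<^sup>2 \<partial>P) \<le> C\<^sup>2"
    and VI_nonempty: "VI_solutions X F \<noteq> {}"
    and samples: "prob_space.indep_vars P (\<lambda>_. borel) \<xi>s UNIV"
      "\<And>k. distr P borel (\<xi>s k) = distr P borel \<xi>"
    and smoothing: "prob_space.indep_vars P (\<lambda>_. borel) z UNIV"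
      "\<And>k. z k \<in> space P \<rightarrow> cball 0 (\<epsilon>s k)"
      "\<And>k. distr P borel (z k) = uniform_measure lborel (cball 0 (\<epsilon>s k))"
    and indep: "indep_vars3 P borel (x 0)
      (PiM UNIV (\<lambda>_. borel)) (\<lambda>\<omega> j. \<xi>s j \<omega>)
      (PiM UNIV (\<lambda>_. borel)) (\<lambda>\<omega> i. z i \<omega>)"
    and pos: "\<And>k. \<gamma> k > 0" "\<And>k. \<eta> k > 0" "\<And>k. \<epsilon>s k > 0"
    and cond_i: "\<And>k. k \<ge> K1 \<Longrightarrow> \<gamma> k / (\<eta> k * (\<epsilon>s k)\<^sup>2) \<le>
      1 / 2 * (real (double_fact (CARD('n) - 1)) /
               (real (double_fact CARD('n)) * kappa CARD('n) * C))\<^sup>2"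
    and cond_ii: "\<And>k. \<epsilon>s k \<le> \<epsilon>"
    and cond_iii: "0 < \<delta>" "\<delta> < 0.5"
      "\<And>k. k \<ge> K3 \<Longrightarrow> \<gamma> k / (\<eta> k * (\<epsilon>s k)\<^sup>2) \<le>
        \<gamma> (k + 1) / (\<eta> (k + 1) * (\<epsilon>s (k + 1))\<^sup>2) * (1 + \<delta> * \<eta> (k + 1) * \<gamma> (k + 1))"
    and cond_iv: "B1 > 0"
      "\<And>k. k \<ge> 1 \<Longrightarrow> (\<epsilon>s k)\<^sup>2 / ((\<eta> (k - 1))\<^sup>2 * \<eta> k * \<gamma> k ^ 3) *
        (1 - min (\<epsilon>s k) (\<epsilon>s (k - 1)) / max (\<epsilon>s k) (\<epsilon>s (k - 1)))\<^sup>2 \<le> B1"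
    and cond_v: "B2 > 0"
      "\<And>k. k \<ge> 1 \<Longrightarrow> (\<epsilon>s k)\<^sup>2 / (\<eta> k * \<gamma> k ^ 3) * (1 - \<eta> k / \<eta> (k - 1))\<^sup>2 \<le> B2"
    and cond_vi: "\<eta>bar > 0" "\<And>k. \<eta> k \<le> \<eta>bar" "\<And>k. k \<ge> K2 \<Longrightarrow> \<eta> k * \<gamma> k < 1"
    and init: "x 0 \<in> space P \<rightarrow> X" "integrable P (\<lambda>\<omega>. (norm (x 0 \<omega>))\<^sup>2)"
    and scheme: "\<And>k \<omega>. \<omega> \<in> space P \<Longrightarrow> x (k + 1) \<omega> =
      closest_point X (x k \<omega> - \<gamma> k *\<^sub>R (\<Phi> (x k \<omega> + z k \<omega>) (\<xi>s k \<omega>) + \<eta> k *\<^sub>R x k \<omega>))"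
    and s: "\<And>k. s k \<in> VI_solutions X (\<lambda>y. smoothed_map P (z k) F y + \<eta> k *\<^sub>R y)"
    and Kbar: "Kbar = Max {K1, K2, K3}"
    and theta: "\<theta> \<ge> max (4 * M\<^sup>2 * (\<eta> Kbar * (\<epsilon>s Kbar)\<^sup>2 / \<gamma> Kbar))
      ((2 * C\<^sup>2 * \<epsilon>\<^sup>2 + 4 * M\<^sup>2 * \<eta>bar\<^sup>2 * \<epsilon>\<^sup>2
          + 16 * (real CARD('n))\<^sup>2 * C\<^sup>2 * B1 + 4 * M\<^sup>2 * B2) / (0.5 - \<delta>))"
  shows "\<forall>k\<ge>Kbar. integrable P (\<lambda>\<omega>. (norm (x (k + 1) \<omega> - s k))\<^sup>2) \<and>
    (\<integral>\<omega>. (norm (x (k + 1) \<omega> - s k))\<^sup>2 \<partial>P) \<le> \<theta> * (\<gamma> k / (\<eta> k * (\<epsilon>s k)\<^sup>2))"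
proof -
  interpret prob_space P by (rule P)

  \<comment> \<open>Extension of the data beyond the enlargement\<close>
  define E where "E = enlargement X \<epsilon>"
  have X_ne: "X \<noteq> {}"
    using s by (auto simp: VI_solutions_def)
  have E_alt: "E = {v + u |v u. v \<in> X \<and> u \<in> cball 0 \<epsilon>}"
    by (simp add: E_def enlargement_def)
  have XE: "v + u \<in> E" if "v \<in> X" "norm u \<le> \<epsilon>" for v u
    using that by (auto simp: E_alt)
  have E: "closed E" "convex E" "E \<noteq> {}"
  proof -
    have "compact E"
      unfolding E_alt using X by (intro compact_sums) (auto simp: compact_eq_bounded_closed)
    then show "closed E" by (rule compact_imp_closed)
    show "convex E"
      unfolding E_alt using convex_sums[OF X(3) convex_cball] by (rule back_subst) blast
    show "E \<noteq> {}"
      using X_ne XE[of _ 0] eps by fastforce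
  qed
  have cpE: "closest_point E u \<in> E" for u
    using E(1,3) by (rule closest_point_in_set)
  \<comment> \<open>Precomposing with the projection onto \<open>E\<close> extends \<open>\<Phi>\<close> and \<open>F\<close> to the whole space
    and keeps measurability, continuity and the moment bound.\<close>
  define \<Psi> where "\<Psi> u w = \<Phi> (closest_point E u) w" for u w
  define G where "G u = F (closest_point E u)" for u
  have cp_meas[measurable]: "closest_point S \<in> borel_measurable borel"
    if "closed S" "convex S" "S \<noteq> {}" for S :: "(real ^ 'n) set"
    using that by (intro borel_measurable_continuous_onI continuous_on_closest_point)
  have cpE_meas[measurable]: "closest_point E \<in> measurable borel (restrict_space borel E)"
    using cpE cp_meas[OF E] by (intro measurable_restrict_space2) auto
  have \<Psi>_meas: "(\<lambda>(u, w). \<Psi> u w) \<in> borel_measurable (borel \<Otimes>\<^sub>M borel)"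
  proof -
    have "(\<lambda>p. (closest_point E (fst p), snd p)) \<in>
        measurable (borel \<Otimes>\<^sub>M borel) (restrict_space borel E \<Otimes>\<^sub>M borel)"
      by measurable
    from measurable_compose[OF this Phi[folded E_def]] show ?thesis
      by (simp add: \<Psi>_def case_prod_beta')
  qed
  have \<Psi>_bound: "integrable P (\<lambda>\<omega>. (norm (\<Psi> u (\<xi> \<omega>)))\<^sup>2)"
      "(\<integral>\<omega>. (norm (\<Psi> u (\<xi> \<omega>)))\<^sup>2 \<partial>P) \<le> C\<^sup>2" for u
    using C(2,3) cpE unfolding \<Psi>_def E_def by auto
  have G_eq: "G u = (\<integral>\<omega>. \<Psi> u (\<xi> \<omega>) \<partial>P)" for u
    using F cpE unfolding G_def \<Psi>_def E_def by auto
  have "continuous_on UNIV G"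
    unfolding G_def using continuous_on_compose2[OF F_cont[folded E_def] continuous_on_closest_point[OF E(2,1,3)]] cpE
    by auto
  then have G_meas[measurable]: "G \<in> borel_measurable borel"
    by (rule borel_measurable_continuous_onI)
  have G_mono: "monotone_map_on E G"
    using F_mono by (simp add: monotone_map_on_def G_def E_def[symmetric] closest_point_self)
  have \<Psi>_comp: "(\<lambda>\<omega>. \<Psi> (f \<omega>) (g \<omega>)) \<in> borel_measurable N"
    if "f \<in> borel_measurable N" "g \<in> borel_measurable N" for f g and N :: "'z measure"
    using measurable_compose[OF measurable_Pair[OF that] \<Psi>_meas] by simp
  have G_le: "norm (G u) \<le> C" for u
    unfolding G_eq using xi by (intro expectation_norm_le(2)[OF _ C(1) \<Psi>_bound] \<Psi>_comp) auto
  \<comment> \<open>All arguments met by the scheme and by the smoothed maps on \<open>X\<close> lie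
    in \<open>E\<close>, where projection is the identity. Replacing \<open>\<Phi>\<close> and
    \<open>F\<close> by \<open>\<Psi>\<close> and \<open>G\<close> therefore changes neither the
    iterates nor the solutions \<open>s k\<close>.\<close>
  have zE: "v + z k \<omega> \<in> E" if "v \<in> X" "\<omega> \<in> space P" for v k \<omega>
    using smoothing(2)[of k] cond_ii[of k] that by (intro XE) force+
  have smoothed_eq: "smoothed_map P (z k) F v = smoothed_map P (z k) G v" if "v \<in> X" for v k
    unfolding smoothed_map_def G_def using zE[OF that]
    by (intro Bochner_Integration.integral_cong refl) (simp add: closest_point_self)
  have s_G: "s k \<in> VI_solutions X (\<lambda>y. smoothed_map P (z k) G y + \<eta> k *\<^sub>R y)" for k
    using s[of k] by (auto simp: VI_solutions_def smoothed_eq)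
  have sX: "s k \<in> X" for k
    using s by (auto simp: VI_solutions_def)
  have xX: "x k \<omega> \<in> X" if "\<omega> \<in> space P" for k \<omega>
    using init(1) scheme[OF that] closest_point_in_set[OF X(1) X_ne] that by (cases k) auto
  have scheme_\<Psi>: "x (Suc k) \<omega> =
      closest_point X (x k \<omega> - \<gamma> k *\<^sub>R (\<Psi> (x k \<omega> + z k \<omega>) (\<xi>s k \<omega>) + \<eta> k *\<^sub>R x k \<omega>))"
    if "\<omega> \<in> space P" for k \<omega>
    using scheme[OF that, of k] zE[OF xX[OF that] that] by (simp add: \<Psi>_def closest_point_self)
  have z_meas[measurable]: "random_variable borel (z k)" and \<xi>s_meas[measurable]: "random_variable borel (\<xi>s k)" for k
    using samples(1) smoothing(1) by (auto simp: indep_vars_def)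
  define h where "h k a b c = closest_point X (a - \<gamma> k *\<^sub>R (\<Psi> (a + b) c + \<eta> k *\<^sub>R a))" for k a b c
  have h_meas: "(\<lambda>((a, b), c). h k a b c) \<in> borel_measurable ((borel \<Otimes>\<^sub>M borel) \<Otimes>\<^sub>M borel)" for k
  proof -
    have [measurable]: "(\<lambda>p. \<Psi> (fst (fst p) + snd (fst p)) (snd p)) \<in> borel_measurable ((borel \<Otimes>\<^sub>M borel) \<Otimes>\<^sub>M borel)"
      by (rule \<Psi>_comp) measurable
    show ?thesis
      unfolding h_def case_prod_beta'
      by (rule measurable_compose[OF _ cp_meas[OF X(1,3) X_ne]]) measurable
  qed
  have scheme_h: "x (Suc k) \<omega> = h k (x k \<omega>) (z k \<omega>) (\<xi>s k \<omega>)" if "\<omega> \<in> space P" for k \<omega>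
    using scheme_\<Psi>[OF that] by (simp add: h_def)
  note rec = recursion_independent[where x = x and Y = \<xi>s and Z = z and h = h, OF samples(1) smoothing(1) indep h_meas scheme_h]
  have x_meas[measurable]: "random_variable borel (x k)" for k
    by (rule rec(1))
  have diff_le: "(norm (u - v))\<^sup>2 \<le> 4 * M\<^sup>2" if "u \<in> X" "v \<in> X" for u v
  proof -
    have "norm (u - v) \<le> 2 * M"
      using norm_triangle_ineq4[of u v] M(2)[OF that(1)] M(2)[OF that(2)] by simp
    from power_mono[OF this norm_ge_zero, of 2] show ?thesis by simp
  qed
  have int: "integrable P (\<lambda>\<omega>. (norm (x k \<omega> - s j))\<^sup>2)" for k j
    using diff_le xX sX by (intro integrable_const_bound[of _ "4 * M\<^sup>2"] AE_I2) auto
  have K: "K1 \<le> Kbar" "K2 \<le> Kbar" "K3 \<le> Kbar"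
    by (auto simp: Kbar)
  define \<nu> where "\<nu> k = \<gamma> k / (\<eta> k * (\<epsilon>s k)\<^sup>2)" for k
  have \<nu>_pos: "0 < \<nu> k" for k
    using pos[of k] by (simp add: \<nu>_def)
  \<comment> \<open>The first entry of the maximum serves the base case: squared distances inside
    \<open>X\<close> are at most 4 M^2.\<close>
  have "4 * M\<^sup>2 * (\<eta> Kbar * (\<epsilon>s Kbar)\<^sup>2 / \<gamma> Kbar) \<le> \<theta>"
    by (rule order_trans[OF max.cobounded1 theta])
  then have base: "4 * M\<^sup>2 \<le> \<theta> * \<nu> Kbar"
    using pos[of Kbar] by (simp add: \<nu>_def field_simps)
  have "0 \<le> \<theta> * \<nu> Kbar"
    using base zero_le_power2[of M] by linarith
  \<comment> \<open>Nonnegativity lets (iii) be multiplied by \<open>\<theta>\<close> in the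
    induction.\<close>
  then have \<theta>: "0 \<le> \<theta>"
    using \<nu>_pos[of Kbar] by (simp add: zero_le_mult_iff)
  have \<theta>_ge: "2 * C\<^sup>2 * \<epsilon>\<^sup>2 + 4 * M\<^sup>2 * \<eta>bar\<^sup>2 * \<epsilon>\<^sup>2 + 16 * (real CARD('n))\<^sup>2 * C\<^sup>2 * B1 + 4 * M\<^sup>2 * B2
      \<le> \<theta> * (1 / 2 - \<delta>)"
    using order_trans[OF max.cobounded2 theta] cond_iii(2) by (subst (asm) pos_divide_le_eq) simp_all

  \<comment> \<open>Drift of the regularised solutions\<close>
  have drift: "(norm (s (Suc k) - s k))\<^sup>2 \<le>
      (8 * (real CARD('n))\<^sup>2 * C\<^sup>2 * B1 + 2 * M\<^sup>2 * B2) * (\<eta> (Suc k) * \<gamma> (Suc k) ^ 3 / (\<epsilon>s (Suc k))\<^sup>2)" for k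
  proof -
    define r where "r = 1 - min (\<epsilon>s (Suc k)) (\<epsilon>s k) / max (\<epsilon>s (Suc k)) (\<epsilon>s k)"
    define e where "e = 1 - \<eta> (Suc k) / \<eta> k"
    \<comment> \<open>The common scale behind (iv) and (v), equal to q t at index
      \<open>Suc k\<close>.\<close>
    define c where "c = \<eta> (Suc k) * \<gamma> (Suc k) ^ 3 / (\<epsilon>s (Suc k))\<^sup>2"
    have iv: "(r / \<eta> k)\<^sup>2 \<le> B1 * c"
      using cond_iv(2)[of "Suc k"] pos[of k] pos[of "Suc k"] by (simp add: r_def[symmetric] c_def field_simps)
    have v: "e\<^sup>2 \<le> B2 * c"
      using cond_v(2)[of "Suc k"] pos[of k] pos[of "Suc k"] unfolding e_def[symmetric] diff_Suc_1
      by (simp add: e_def[symmetric] c_def field_simps)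
    have "monotone_map_on X (smoothed_map P (z k) G)"
      using zE G_le by (intro smoothed_map_monotone[OF G_mono] integrable_const_bound[of _ C]) auto
    \<comment> \<open>The older index \<open>k\<close> takes the primed role, so the divisor is
      \<open>\<eta> k\<close>, the one that (iv) and (v) contain after the shift to
      \<open>Suc k\<close>.\<close>
    from regularized_VI_drift[OF s_G[of "Suc k"] s_G[of k] this pos(2)]
    have "norm (s (Suc k) - s k) \<le>
        norm (smoothed_map P (z (Suc k)) G (s (Suc k)) - smoothed_map P (z k) G (s (Suc k))) / \<eta> k
          + norm (s (Suc k)) * \<bar>e\<bar>"
      by (simp add: e_def)
    also have "\<dots> \<le> (2 * real CARD('n) * C * r) / \<eta> k + M * \<bar>e\<bar>"
      using smoothed_map_uniform_diff[OF G_meas G_le z_meas z_meas smoothing(3)[of "Suc k"] smoothing(3)[of k]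
            pos(3) pos(3), of "s (Suc k)"]
        pos(2)[of k] M(2)[OF sX]
      by (intro add_mono divide_right_mono mult_right_mono) (auto simp: r_def)
    finally have "(norm (s (Suc k) - s k))\<^sup>2 \<le> ((2 * real CARD('n) * C) * (r / \<eta> k) + M * \<bar>e\<bar>)\<^sup>2"
      by (intro power_mono) auto
    also have "\<dots> \<le> 2 * ((2 * real CARD('n) * C) * (r / \<eta> k))\<^sup>2 + 2 * (M * \<bar>e\<bar>)\<^sup>2"
      using zero_le_power2[of "(2 * real CARD('n) * C) * (r / \<eta> k) - M * \<bar>e\<bar>"]
      unfolding power2_diff power2_sum by linarith
    also have "\<dots> = 8 * (real CARD('n))\<^sup>2 * C\<^sup>2 * (r / \<eta> k)\<^sup>2 + 2 * M\<^sup>2 * e\<^sup>2"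
      unfolding power_mult_distrib power2_abs by simp
    also have "\<dots> \<le> 8 * (real CARD('n))\<^sup>2 * C\<^sup>2 * (B1 * c) + 2 * M\<^sup>2 * (B2 * c)"
      by (intro add_mono mult_left_mono iv v) auto
    finally show ?thesis
      by (simp add: c_def[symmetric] algebra_simps)
  qed

  \<comment> \<open>Induction on the step index\<close>
  have main: "(\<integral>\<omega>. (norm (x (Suc k) \<omega> - s k))\<^sup>2 \<partial>P) \<le> \<theta> * \<nu> k" if "Kbar \<le> k" for k
    using that
  proof (induction k rule: dec_induct)
    case base
    have "(\<integral>\<omega>. (norm (x (Suc Kbar) \<omega> - s Kbar))\<^sup>2 \<partial>P) \<le> (\<integral>\<omega>. 4 * M\<^sup>2 \<partial>P)"
      using diff_le xX sX by (intro integral_mono int) auto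
    also have "\<dots> = 4 * M\<^sup>2"
      by (simp add: prob_space)
    finally show ?case using \<open>4 * M\<^sup>2 \<le> \<theta> * \<nu> Kbar\<close> by linarith
  next
    case (step j)
    define k where "k = Suc j"
    define q where "q = \<eta> k * \<gamma> k"
    \<comment> \<open>This is \<open>q * \<nu> k\<close>, the unit in which drift, noise and gain
      are compared.\<close>
    define t where "t = (\<gamma> k)\<^sup>2 / (\<epsilon>s k)\<^sup>2"
    have p: "0 < \<eta> k" "0 < \<gamma> k" "0 < \<epsilon>s k" using pos by auto
    have q: "0 < q" "q < 1"
      using p cond_vi(3)[of k] K step(1) by (auto simp: q_def k_def)
    have step_k: "(\<integral>\<omega>. (norm (x (Suc k) \<omega> - s k))\<^sup>2 \<partial>P) \<le>
        (1 - 2 * q) * (\<integral>\<omega>. (norm (x k \<omega> - s k))\<^sup>2 \<partial>P) + (\<gamma> k)\<^sup>2 * (2 * C\<^sup>2 + 2 * (\<eta> k)\<^sup>2 * M\<^sup>2)"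
      unfolding q_def
      by (rule projected_step_expectation[OF X(1,3) M(2) x_meas z_meas \<xi>s_meas xi xX zE[OF xX] zE[OF sX] \<Psi>_meas C(1)
            \<Psi>_bound G_eq G_meas G_mono samples(2) rec(2,3) s_G p(2,1) scheme_\<Psi> int])
    have "(\<integral>\<omega>. (norm (x k \<omega> - s k))\<^sup>2 \<partial>P) \<le>
        (\<integral>\<omega>. (1 + q) * (norm (x k \<omega> - s j))\<^sup>2 + (1 + 1 / q) * (norm (s k - s j))\<^sup>2 \<partial>P)"
    proof (rule integral_mono[OF int])
      show "(norm (x k \<omega> - s k))\<^sup>2 \<le> (1 + q) * (norm (x k \<omega> - s j))\<^sup>2 + (1 + 1 / q) * (norm (s k - s j))\<^sup>2" for \<omega>
        using norm_add_power2_le[OF q(1), of "x k \<omega> - s j" "s j - s k"] by (simp add: norm_minus_commute)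
    qed (use int in simp)
    also have "\<dots> = (1 + q) * (\<integral>\<omega>. (norm (x k \<omega> - s j))\<^sup>2 \<partial>P) + (1 + 1 / q) * (norm (s k - s j))\<^sup>2"
      using int by (simp add: prob_space)
    finally have moved: "(\<integral>\<omega>. (norm (x k \<omega> - s k))\<^sup>2 \<partial>P) \<le> \<dots>" .
    have "\<nu> j \<le> \<nu> k * (1 + \<delta> * q)"
      using cond_iii(3)[of j] K step(1) by (simp add: \<nu>_def k_def q_def mult.assoc)
    with \<theta> have "\<theta> * \<nu> j \<le> (1 + \<delta> * q) * (\<theta> * \<nu> k)"
      by (simp add: mult_left_mono mult_ac)
    with step(3) have IH: "(\<integral>\<omega>. (norm (x k \<omega> - s j))\<^sup>2 \<partial>P) \<le> (1 + \<delta> * q) * (\<theta> * \<nu> k)"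
      by (simp add: k_def)
    have "(\<integral>\<omega>. (norm (x (Suc k) \<omega> - s k))\<^sup>2 \<partial>P) \<le> (1 - (1 / 2 - \<delta>) * q) * (\<theta> * \<nu> k)
        + (norm (s k - s j))\<^sup>2 / q + (\<gamma> k)\<^sup>2 * (2 * C\<^sup>2 + 2 * (\<eta> k)\<^sup>2 * M\<^sup>2)"
      using cond_iii(1,2) \<theta> \<nu>_pos[of k]
      by (intro contraction_with_drift[OF step_k _ moved _ IH _ _ q]) auto
    \<comment> \<open>Dividing \<open>drift\<close> by \<open>q\<close> turns its scale into
      \<open>t\<close>; the constants 8 and 2 are then relaxed to the 16 and 4 in the bound on
      \<open>\<theta>\<close>.\<close>
    also have "(norm (s k - s j))\<^sup>2 / q \<le> (16 * (real CARD('n))\<^sup>2 * C\<^sup>2 * B1 + 4 * M\<^sup>2 * B2) * t"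
    proof -
      have "(norm (s k - s j))\<^sup>2 / q \<le> (8 * (real CARD('n))\<^sup>2 * C\<^sup>2 * B1 + 2 * M\<^sup>2 * B2) * (\<eta> k * \<gamma> k ^ 3 / (\<epsilon>s k)\<^sup>2) / q"
        using drift[of j] q by (intro divide_right_mono) (auto simp: k_def)
      also have "\<dots> = (8 * (real CARD('n))\<^sup>2 * C\<^sup>2 * B1 + 2 * M\<^sup>2 * B2) * t"
        using p by (simp add: q_def t_def field_simps power2_eq_square power3_eq_cube)
      also have "\<dots> \<le> (16 * (real CARD('n))\<^sup>2 * C\<^sup>2 * B1 + 4 * M\<^sup>2 * B2) * t"
        using cond_iv(1) cond_v(1) p by (intro mult_right_mono add_mono) (auto simp: t_def)
      finally show ?thesis .
    qed
    also have "(\<gamma> k)\<^sup>2 * (2 * C\<^sup>2 + 2 * (\<eta> k)\<^sup>2 * M\<^sup>2) \<le> (2 * C\<^sup>2 * \<epsilon>\<^sup>2 + 4 * M\<^sup>2 * \<eta>bar\<^sup>2 * \<epsilon>\<^sup>2) * t"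
    proof -
      have "(\<gamma> k)\<^sup>2 * (2 * C\<^sup>2 + 2 * (\<eta> k)\<^sup>2 * M\<^sup>2) =
          t * ((\<epsilon>s k)\<^sup>2 * (2 * C\<^sup>2 + 2 * (\<eta> k)\<^sup>2 * M\<^sup>2))"
        using p by (simp add: t_def)
      also have "\<dots> \<le> t * (\<epsilon>\<^sup>2 * (2 * C\<^sup>2 + 4 * \<eta>bar\<^sup>2 * M\<^sup>2))"
        using p C(1) M(1) cond_ii[of k] cond_vi(2)[of k]
        by (intro mult_left_mono[of _ _ t] mult_mono add_mono power_mono) (auto simp: t_def)
      also have "\<dots> = (2 * C\<^sup>2 * \<epsilon>\<^sup>2 + 4 * M\<^sup>2 * \<eta>bar\<^sup>2 * \<epsilon>\<^sup>2) * t"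
        by (simp add: algebra_simps)
      finally show ?thesis .
    qed
    \<comment> \<open>Because \<open>\<nu> k * q = t\<close>, the gain is theta (1/2 - delta) t, and
      \<open>\<theta>_ge\<close> times \<open>t\<close> says that it covers both remaining
      terms.\<close>
    also have "(1 - (1 / 2 - \<delta>) * q) * (\<theta> * \<nu> k) + (16 * (real CARD('n))\<^sup>2 * C\<^sup>2 * B1 + 4 * M\<^sup>2 * B2) * t
        + (2 * C\<^sup>2 * \<epsilon>\<^sup>2 + 4 * M\<^sup>2 * \<eta>bar\<^sup>2 * \<epsilon>\<^sup>2) * t \<le> \<theta> * \<nu> k"
    proof -
      have "\<nu> k * q = t"
        using p by (simp add: \<nu>_def q_def t_def power2_eq_square)
      then have "(1 / 2 - \<delta>) * q * (\<theta> * \<nu> k) = \<theta> * (1 / 2 - \<delta>) * t"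
        by (simp add: mult_ac)
      moreover have "0 \<le> t" by (simp add: t_def)
      ultimately show ?thesis
        using mult_right_mono[OF \<theta>_ge, of t] by (simp add: left_diff_distrib distrib_right)
    qed
    finally show ?case by (simp add: k_def)
  qed
  show ?thesis
    using int main by (simp add: \<nu>_def)
qed

end
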